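(* Let $S,S'\subset\mathbb R^3$ be two (local, smooth) pseudospherical surfaces of equal constant negative Gaussian curvatures $K=K'=-\kappa^2$, $\kappa\ne0$. Consider a parallelism between $S$ and $S'$ and the corresponding middle surface $\bar S$, assumed regular. On $\bar S$ consider the images, under the parallelism, of the asymptotic lines of $S$ and of the asymptotic lines of $S'$ (altogether four families of curves). Assume that the parallelism takes no asymptotic direction of $S$ to an asymptotic direction of $S'$. Then these images combine to two concordant Chebyshev nets on $\bar S$: the four families can be grouped into two pairs, each consisting of one family coming from $S$ and one family coming from $S'$, such that each pair is a concordant Chebyshev net on $\bar S$.
   Context: All considerations are local and smooth. A parallelism between surfaces $S,S'$ with Gauss maps $\gamma:S\to\mathbb S^2$, $\gamma':S'\to\mathbb S^2$ is a (diffeomorphic) correspondence $p\leftrightarrow p'$ between them with $\gamma(p)=\gamma'(p')$, i.e. corresponding points have equal unit normals. The middle surface $\bar S$ is the locus of midpoints $\tfrac12 p+\tfrac12 p'$ of corresponding points; it corresponds to $S$ and $S'$ via $p\mapsto \tfrac12 p+\tfrac12p'$, and it has the same unit normals at corresponding points. Asymptotic directions $X$ are those with $\mathrm{II}(X,X)=0$, and asymptotic lines are their integral curves; each of $S,S'$ has two families of them. A net on a surface is a pair of transversal foliations by curves, equivalently a pair of distinct direction fields represented by tangent vector fields $X_1,X_2$ (each up to multiplication by a nowhere zero function). The net is Chebyshev if locally there are parameters $(x,y)$ whose coordinate curves are the curves of the net and in which the first fundamental form is $dx^2+2\cos\omega\,dx\,dy+dy^2$; equivalently, the unit vector fields tangent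 to the two families commute. The Schief curvature of the net, on a surface with position vector $\mathbf r$ and unit normal $\mathbf n$, is $\sigma=\dfrac{(X_2X_1\mathbf r)\cdot\mathbf n}{\|X_1\mathbf r\times X_2\mathbf r\|}$, which up to sign does not depend on the choice of $X_1,X_2$. The net is concordant if the Gauss curvature of the surface satisfies $K=c\,\sigma$ for some real constant $c$. *)

theory Defs
  imports "HOL-Analysis.Analysis"
begin

text \<open>
  Local surfaces are given by regular parametrizations \<open>r :: real \<times> real \<Rightarrow> real ^ 3\<close> on an open set
  \<open>U\<close> of parameters, which need not be injective. A tangent vector of the surface at \<open>r p\<close> is
  represented by a vector \<open>v\<close> of the parameter plane, standing for \<open>dr(v)\<close>. A correspondence between
  surfaces is expressed by parametrizing them over the same \<open>U\<close>, with \<open>r p\<close> and \<open>r' p\<close>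
  corresponding; a direction field \<open>X :: real \<times> real \<Rightarrow> real \<times> real\<close> then represents a
  direction field on one surface and, at the same time, its image on the other.
\<close>

primrec Ck_on :: "nat \<Rightarrow> 'a::real_normed_vector set \<Rightarrow> ('a \<Rightarrow> 'b::real_normed_vector) \<Rightarrow> bool" where
  "Ck_on 0 U f \<longleftrightarrow> continuous_on U f"
| "Ck_on (Suc k) U f \<longleftrightarrow> (\<forall>p\<in>U. f differentiable (at p)) \<and>
     (\<forall>v. Ck_on k U (\<lambda>p. frechet_derivative f (at p) v))"

text \<open>Meaningful for open \<open>U\<close> and finite-dimensional domain, where it says that partial derivatives
  of all orders exist and are continuous.\<close>

definition smooth_on :: "'a::real_normed_vector set \<Rightarrow> ('a \<Rightarrow> 'b::real_normed_vector) \<Rightarrow> bool" where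
  "smooth_on U f \<longleftrightarrow> (\<forall>k. Ck_on k U f)"

definition vf_deriv :: "('a::real_normed_vector \<Rightarrow> 'a) \<Rightarrow> ('a \<Rightarrow> 'b::real_normed_vector) \<Rightarrow> 'a \<Rightarrow> 'b" where
  "vf_deriv X f p = frechet_derivative f (at p) (X p)"

definition regular_surface :: "(real \<times> real) set \<Rightarrow> (real \<times> real \<Rightarrow> real ^ 3) \<Rightarrow> bool" where
  "regular_surface U r \<longleftrightarrow> open U \<and> smooth_on U r \<and>
     (\<forall>p\<in>U. inj (frechet_derivative r (at p)))"

definition gauss_map ::
  "(real \<times> real) set \<Rightarrow> (real \<times> real \<Rightarrow> real ^ 3) \<Rightarrow> (real \<times> real \<Rightarrow> real ^ 3) \<Rightarrow> bool" where
  "gauss_map U r n \<longleftrightarrow> smooth_on U n \<and>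
     (\<forall>p\<in>U. norm (n p) = 1 \<and> (\<forall>v. frechet_derivative r (at p) v \<bullet> n p = 0))"

definition first_form ::
  "(real \<times> real \<Rightarrow> real ^ 3) \<Rightarrow> real \<times> real \<Rightarrow> real \<times> real \<Rightarrow> real \<times> real \<Rightarrow> real" where
  "first_form r p v w = frechet_derivative r (at p) v \<bullet> frechet_derivative r (at p) w"

text \<open>\<open>II(v, w) = - dr(v) \<cdot> dn(w)\<close>; differentiating \<open>dr(v) \<cdot> n = 0\<close> shows that this is
  \<open>d\<^sup>2r(v, w) \<cdot> n\<close>.\<close>

definition second_form ::
  "(real \<times> real \<Rightarrow> real ^ 3) \<Rightarrow> (real \<times> real \<Rightarrow> real ^ 3) \<Rightarrow>
   real \<times> real \<Rightarrow> real \<times> real \<Rightarrow> real \<times> real \<Rightarrow> real" where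
  "second_form r n p v w = - (frechet_derivative r (at p) v \<bullet> frechet_derivative n (at p) w)"

definition gauss_curvature ::
  "(real \<times> real \<Rightarrow> real ^ 3) \<Rightarrow> (real \<times> real \<Rightarrow> real ^ 3) \<Rightarrow> real \<times> real \<Rightarrow> real" where
  "gauss_curvature r n p =
     (second_form r n p (1,0) (1,0) * second_form r n p (0,1) (0,1) - (second_form r n p (1,0) (0,1))\<^sup>2) /
     (first_form r p (1,0) (1,0) * first_form r p (0,1) (0,1) - (first_form r p (1,0) (0,1))\<^sup>2)"

definition net_on ::
  "(real \<times> real) set \<Rightarrow> (real \<times> real \<Rightarrow> real \<times> real) \<Rightarrow> (real \<times> real \<Rightarrow> real \<times> real) \<Rightarrow> bool" where
  "net_on U X1 X2 \<longleftrightarrow> smooth_on U X1 \<and> smooth_on U X2 \<and>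
     (\<forall>p\<in>U. \<forall>a b. a *\<^sub>R X1 p + b *\<^sub>R X2 p = 0 \<longrightarrow> a = 0 \<and> b = 0)"

definition asymptotic_direction ::
  "(real \<times> real \<Rightarrow> real ^ 3) \<Rightarrow> (real \<times> real \<Rightarrow> real ^ 3) \<Rightarrow> real \<times> real \<Rightarrow> real \<times> real \<Rightarrow> bool" where
  "asymptotic_direction r n p v \<longleftrightarrow> v \<noteq> 0 \<and> second_form r n p v v = 0"

text \<open>The integral curves of \<open>X1\<close> and of \<open>X2\<close> are the two families of asymptotic lines.\<close>

definition asymptotic_net ::
  "(real \<times> real) set \<Rightarrow> (real \<times> real \<Rightarrow> real ^ 3) \<Rightarrow> (real \<times> real \<Rightarrow> real ^ 3) \<Rightarrow>
   (real \<times> real \<Rightarrow> real \<times> real) \<Rightarrow> (real \<times> real \<Rightarrow> real \<times> real) \<Rightarrow> bool" where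
  "asymptotic_net U r n X1 X2 \<longleftrightarrow> net_on U X1 X2 \<and>
     (\<forall>p\<in>U. asymptotic_direction r n p (X1 p) \<and> asymptotic_direction r n p (X2 p))"

text \<open>\<open>\<phi> :: W \<rightarrow> V\<close>, with inverse \<open>\<psi>\<close>, is the change from the parameters \<open>(x, y) \<in> W\<close> of the
  Chebyshev net to the given ones; the first fundamental form is then that of \<open>r \<circ> \<phi>\<close>. Since \<open>\<phi>\<close> is a
  diffeomorphism, the factors \<open>a\<close> and \<open>b\<close> cannot vanish.\<close>

definition chebyshev_net ::
  "(real \<times> real) set \<Rightarrow> (real \<times> real \<Rightarrow> real ^ 3) \<Rightarrow>
   (real \<times> real \<Rightarrow> real \<times> real) \<Rightarrow> (real \<times> real \<Rightarrow> real \<times> real) \<Rightarrow> bool" where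
  "chebyshev_net U r X1 X2 \<longleftrightarrow> net_on U X1 X2 \<and>
     (\<forall>p\<in>U. \<exists>V W \<phi> \<psi> \<omega>.
        open V \<and> p \<in> V \<and> V \<subseteq> U \<and> open W \<and>
        homeomorphism W V \<phi> \<psi> \<and> smooth_on W \<phi> \<and> smooth_on V \<psi> \<and> smooth_on W (\<omega> :: real \<times> real \<Rightarrow> real) \<and>
        (\<forall>q\<in>W.
           (\<exists>a. frechet_derivative \<phi> (at q) (1,0) = a *\<^sub>R X1 (\<phi> q)) \<and>
           (\<exists>b. frechet_derivative \<phi> (at q) (0,1) = b *\<^sub>R X2 (\<phi> q)) \<and>
           first_form (r \<circ> \<phi>) q (1,0) (1,0) = 1 \<and>
           first_form (r \<circ> \<phi>) q (1,0) (0,1) = cos (\<omega> q) \<and>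
           first_form (r \<circ> \<phi>) q (0,1) (0,1) = 1))"

definition schief_curvature ::
  "(real \<times> real \<Rightarrow> real ^ 3) \<Rightarrow> (real \<times> real \<Rightarrow> real ^ 3) \<Rightarrow>
   (real \<times> real \<Rightarrow> real \<times> real) \<Rightarrow> (real \<times> real \<Rightarrow> real \<times> real) \<Rightarrow> real \<times> real \<Rightarrow> real" where
  "schief_curvature r n X1 X2 p =
     (vf_deriv X2 (vf_deriv X1 r) p \<bullet> n p) / norm (cross3 (vf_deriv X1 r p) (vf_deriv X2 r p))"

text \<open>Rescaling \<open>X1\<close> or \<open>X2\<close> by a negative function changes the sign of the Schief curvature, so
  this notion is independent of the chosen representatives only on connected \<open>U\<close>.\<close>

definition concordant_net ::
  "(real \<times> real) set \<Rightarrow> (real \<times> real \<Rightarrow> real ^ 3) \<Rightarrow> (real \<times> real \<Rightarrow> real ^ 3) \<Rightarrow>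
   (real \<times> real \<Rightarrow> real \<times> real) \<Rightarrow> (real \<times> real \<Rightarrow> real \<times> real) \<Rightarrow> bool" where
  "concordant_net U r n X1 X2 \<longleftrightarrow> net_on U X1 X2 \<and>
     (\<exists>c. \<forall>p\<in>U. gauss_curvature r n p = c * schief_curvature r n X1 X2 p)"

definition concordant_chebyshev_net ::
  "(real \<times> real) set \<Rightarrow> (real \<times> real \<Rightarrow> real ^ 3) \<Rightarrow> (real \<times> real \<Rightarrow> real ^ 3) \<Rightarrow>
   (real \<times> real \<Rightarrow> real \<times> real) \<Rightarrow> (real \<times> real \<Rightarrow> real \<times> real) \<Rightarrow> bool" where
  "concordant_chebyshev_net U r n X1 X2 \<longleftrightarrow> chebyshev_net U r X1 X2 \<and> concordant_net U r n X1 X2"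

definition parallel_surfaces ::
  "(real \<times> real) set \<Rightarrow> (real \<times> real \<Rightarrow> real ^ 3) \<Rightarrow> (real \<times> real \<Rightarrow> real ^ 3) \<Rightarrow>
   (real \<times> real \<Rightarrow> real ^ 3) \<Rightarrow> (real \<times> real \<Rightarrow> real ^ 3) \<Rightarrow> bool" where
  "parallel_surfaces U r n r' n' \<longleftrightarrow>
     regular_surface U r \<and> gauss_map U r n \<and> regular_surface U r' \<and> gauss_map U r' n' \<and>
     (\<forall>p\<in>U. n p = n' p)"

text \<open>The middle surface of parallel surfaces has their common unit normals, because the
  differential of its position vector is the mean of those of \<open>r\<close> and \<open>r'\<close>.\<close>

definition middle_surface ::
  "(real \<times> real \<Rightarrow> real ^ 3) \<Rightarrow> (real \<times> real \<Rightarrow> real ^ 3) \<Rightarrow> real \<times> real \<Rightarrow> real ^ 3" where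
  "middle_surface r r' p = (1/2) *\<^sub>R r p + (1/2) *\<^sub>R r' p"

end

theory Submission
  imports Defs
begin

text \<open>
  By Beltrami--Enneper, along an asymptotic direction \<open>X\<close> of a surface with \<open>K = - \<kappa>\<^sup>2\<close> one has
  \<open>r\<^sub>X = m n \<times> n\<^sub>X\<close> with \<open>m = \<plusminus>1/\<kappa>\<close>, the two families having opposite signs. Pair a family \<open>X\<close> of \<open>S\<close>
  with a family \<open>Y\<close> of \<open>S'\<close> of the opposite sign: \<open>r\<^sub>X = m n \<times> n\<^sub>X\<close> and \<open>r'\<^sub>Y = - m n \<times> n\<^sub>Y\<close>. Were \<open>X\<close> and \<open>Y\<close>
  coordinate fields, differentiating the first equation along \<open>Y\<close> and the second along \<open>X\<close> and adding
  would make the terms \<open>n \<times> n\<^sub>X\<^sub>Y\<close> cancel, so that the mixed derivative of the middle surface is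
  \<open>- m n\<^sub>X \<times> n\<^sub>Y\<close>. It is normal, hence \<open>X\<close> and \<open>Y\<close> form a Chebyshev net, and as
  \<open>n\<^sub>X \<times> n\<^sub>Y\<close> is the Gauss curvature times the cross product of the two tangent vectors of the middle
  surface, the net is concordant with constant \<open>\<plusminus>1/m\<close>. For general \<open>X\<close> and \<open>Y\<close> the Lie bracket
  \<open>[X, Y] = \<alpha> X + \<beta> Y\<close> contributes the term \<open>- \<alpha>\<close> times the \<open>X\<close>-derivative of the middle surface; when
  the fields have unit length there, orthogonality of a unit field to its derivatives gives
  \<open>\<alpha> = \<beta> = 0\<close>. The coframe dual to commuting fields is closed, so the Poincare lemma and the inverse
  function theorem provide the coordinates without solving differential equations.
\<close>

section \<open>Calculus of smooth maps\<close>

abbreviation fd :: "('a::real_normed_vector \<Rightarrow> 'b::real_normed_vector) \<Rightarrow> 'a \<Rightarrow> 'a \<Rightarrow> 'b" where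
  "fd f p \<equiv> frechet_derivative f (at p)"

lemma has_derivative_cong_open:
  assumes "open U" "p \<in> U" "\<And>q. q \<in> U \<Longrightarrow> f q = g q"
  shows "(f has_derivative f') (at p) \<longleftrightarrow> (g has_derivative f') (at p)"
  using assms by (metis has_derivative_transform_within_open)

lemma frechet_derivative_cong_open:
  assumes "open U" "p \<in> U" "\<And>q. q \<in> U \<Longrightarrow> f q = g q"
  shows "fd f p = fd g p"
  unfolding frechet_derivative_def by (simp only: has_derivative_cong_open[OF assms])

lemma Ck_on_cong:
  assumes "open U" "\<And>p. p \<in> U \<Longrightarrow> f p = g p"
  shows "Ck_on k U f \<longleftrightarrow> Ck_on k U g"
  using assms(2)
proof (induction k arbitrary: f g)
  case 0
  then show ?case unfolding Ck_on.simps by (intro continuous_on_cong) auto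
next
  case (Suc k)
  have "fd f p = fd g p" if "p \<in> U" for p
    by (rule frechet_derivative_cong_open[OF assms(1) that Suc.prems])
  then have "Ck_on k U (\<lambda>p. fd f p v) \<longleftrightarrow> Ck_on k U (\<lambda>p. fd g p v)" for v
    by (intro Suc.IH) simp
  moreover have "f differentiable (at p) \<longleftrightarrow> g differentiable (at p)" if "p \<in> U" for p
    unfolding differentiable_def by (simp only: has_derivative_cong_open[OF assms(1) that Suc.prems])
  ultimately show ?case unfolding Ck_on.simps by blast
qed

lemma Ck_on_subset: "Ck_on k U f \<Longrightarrow> V \<subseteq> U \<Longrightarrow> Ck_on k V f"
  by (induction k arbitrary: f) (auto intro: continuous_on_subset)

lemma Ck_on_SucD: "Ck_on (Suc k) U f \<Longrightarrow> Ck_on k U f"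
proof (induction k arbitrary: f)
  case 0
  then show ?case
    by (auto intro!: continuous_at_imp_continuous_on differentiable_imp_continuous_within)
next
  case (Suc k)
  have "\<forall>p\<in>U. f differentiable (at p)" "\<And>v. Ck_on (Suc k) U (\<lambda>p. fd f p v)"
    using Suc.prems unfolding Ck_on.simps(2)[of "Suc k"] by blast+
  then show ?case using Suc.IH unfolding Ck_on.simps(2)[of k] by blast
qed

text \<open>Lets inductions on \<open>k\<close> work with an explicit derivative formula
  \<open>f'\<close>. Since \<open>U\<close> is open, replacing \<open>frechet_derivative\<close> by
  \<open>f'\<close> at the points of \<open>U\<close> does not affect \<open>Ck_on\<close>.\<close>

lemma Ck_on_SucI:
  assumes "open U" "\<And>p. p \<in> U \<Longrightarrow> (f has_derivative f' p) (at p)"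
    and "\<And>v. Ck_on k U (\<lambda>p. f' p v)"
  shows "Ck_on (Suc k) U f"
proof -
  have "fd f p = f' p" if "p \<in> U" for p
    by (rule frechet_derivative_at[OF assms(2)[OF that], symmetric])
  then have "Ck_on k U (\<lambda>p. fd f p v)" for v
    using assms(3)[of v] by (subst Ck_on_cong[OF assms(1), where g = "\<lambda>p. f' p v"]) simp_all
  moreover have "\<forall>p\<in>U. f differentiable (at p)"
    by (intro ballI differentiableI[OF assms(2)])
  ultimately show ?thesis by simp
qed

lemma Ck_on_has_derivative: "Ck_on (Suc k) U f \<Longrightarrow> p \<in> U \<Longrightarrow> (f has_derivative fd f p) (at p)"
  by (rule iffD1[OF frechet_derivative_works]) simp

lemma Ck_on_const: "open U \<Longrightarrow> Ck_on k U (\<lambda>p. c)"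
proof (induction k arbitrary: c)
  case 0
  then show ?case by simp
next
  case (Suc k)
  show ?case
    by (rule Ck_on_SucI[where f' = "\<lambda>p v. 0", OF Suc.prems has_derivative_const Suc.IH[OF Suc.prems]])
qed

lemma Ck_on_linear:
  assumes "bounded_linear L" "open U" "Ck_on k U f"
  shows "Ck_on k U (\<lambda>p. L (f p))"
  using assms(3)
proof (induction k arbitrary: f)
  case 0
  then show ?case unfolding Ck_on.simps by (rule bounded_linear.continuous_on[OF assms(1)])
next
  case (Suc k)
  show ?case
  proof (rule Ck_on_SucI[where f' = "\<lambda>p v. L (fd f p v)", OF assms(2)])
    show "((\<lambda>p. L (f p)) has_derivative (\<lambda>v. L (fd f p v))) (at p)" if "p \<in> U" for p
      by (rule bounded_linear.has_derivative[OF assms(1) Ck_on_has_derivative[OF Suc.prems that]])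
    show "Ck_on k U (\<lambda>p. L (fd f p v))" for v using Suc by simp
  qed
qed

lemma Ck_on_add:
  assumes "open U" "Ck_on k U f" "Ck_on k U g"
  shows "Ck_on k U (\<lambda>p. f p + g p)"
  using assms(2,3)
proof (induction k arbitrary: f g)
  case 0
  then show ?case unfolding Ck_on.simps by (rule continuous_on_add)
next
  case (Suc k)
  show ?case
  proof (rule Ck_on_SucI[where f' = "\<lambda>p v. fd f p v + fd g p v", OF assms(1)])
    show "((\<lambda>p. f p + g p) has_derivative (\<lambda>v. fd f p v + fd g p v)) (at p)" if "p \<in> U" for p
      by (intro has_derivative_add Ck_on_has_derivative[OF Suc.prems(1) that]
          Ck_on_has_derivative[OF Suc.prems(2) that])
    show "Ck_on k U (\<lambda>p. fd f p v + fd g p v)" for v using Suc by simp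
  qed
qed

lemma Ck_on_sum:
  assumes "open U" "\<And>i. i \<in> I \<Longrightarrow> Ck_on k U (f i)"
  shows "Ck_on k U (\<lambda>p. \<Sum>i\<in>I. f i p)"
  using assms by (induction I rule: infinite_finite_induct) (auto intro: Ck_on_const Ck_on_add)

lemma Ck_on_bilinear:
  assumes "bounded_bilinear B" "open U" "Ck_on k U f" "Ck_on k U g"
  shows "Ck_on k U (\<lambda>p. B (f p) (g p))"
  using assms(3,4)
proof (induction k arbitrary: f g)
  case 0
  then show ?case unfolding Ck_on.simps by (rule bounded_bilinear.continuous_on[OF assms(1)])
next
  case (Suc k)
  show ?case
  proof (rule Ck_on_SucI[where f' = "\<lambda>p v. B (f p) (fd g p v) + B (fd f p v) (g p)", OF assms(2)])
    show "((\<lambda>p. B (f p) (g p)) has_derivative (\<lambda>v. B (f p) (fd g p v) + B (fd f p v) (g p))) (at p)"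
      if "p \<in> U" for p
      by (rule bounded_bilinear.FDERIV[OF assms(1) Ck_on_has_derivative[OF Suc.prems(1) that]
            Ck_on_has_derivative[OF Suc.prems(2) that]])
    show "Ck_on k U (\<lambda>p. B (f p) (fd g p v) + B (fd f p v) (g p))" for v
      using Suc.prems Ck_on_SucD[OF Suc.prems(1)] Ck_on_SucD[OF Suc.prems(2)]
      by (intro Ck_on_add assms(2) Suc.IH) auto
  qed
qed

lemma linear_eq_sum_Basis:
  fixes L :: "'a::euclidean_space \<Rightarrow> 'b::real_vector"
  assumes "linear L"
  shows "L x = (\<Sum>b\<in>Basis. (x \<bullet> b) *\<^sub>R L b)"
proof -
  have "L x = L (\<Sum>b\<in>Basis. (x \<bullet> b) *\<^sub>R b)" by (simp add: euclidean_representation)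
  also have "\<dots> = (\<Sum>b\<in>Basis. (x \<bullet> b) *\<^sub>R L b)"
    by (simp add: linear_sum[OF assms] linear_cmul[OF assms])
  finally show ?thesis .
qed

text \<open>The chain rule produces \<open>fd g (f p)\<close> in the varying direction
  \<open>fd f p v\<close>, whereas \<open>Ck_on\<close> speaks of fixed directions. Expanding in the
  basis leaves composites of \<open>f\<close> with partial derivatives of \<open>g\<close>, to which
  the induction hypothesis applies.\<close>

lemma Ck_on_compose:
  fixes g :: "'b::euclidean_space \<Rightarrow> 'c::real_normed_vector"
  assumes "open U" "open T" "f ` U \<subseteq> T" "Ck_on k U f" "Ck_on k T g"
  shows "Ck_on k U (\<lambda>p. g (f p))"
  using assms(4,5)
proof (induction k arbitrary: g)
  case 0
  then show ?case using assms(3) by (auto intro: continuous_on_compose2)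
next
  case (Suc k)
  show ?case
  proof (rule Ck_on_SucI[where f' = "\<lambda>p v. \<Sum>b\<in>Basis. (fd f p v \<bullet> b) *\<^sub>R fd g (f p) b"])
    fix p assume p: "p \<in> U"
    have g: "(g has_derivative fd g (f p)) (at (f p))"
      using Ck_on_has_derivative[OF Suc.prems(2)] p assms(3) by blast
    have "((\<lambda>p. g (f p)) has_derivative (\<lambda>v. fd g (f p) (fd f p v))) (at p)"
      by (rule has_derivative_compose[OF Ck_on_has_derivative[OF Suc.prems(1) p] g])
    moreover have "(\<lambda>v. fd g (f p) (fd f p v)) = (\<lambda>v. \<Sum>b\<in>Basis. (fd f p v \<bullet> b) *\<^sub>R fd g (f p) b)"
      by (rule ext, rule linear_eq_sum_Basis[OF has_derivative_linear[OF g]])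
    ultimately show "((\<lambda>p. g (f p)) has_derivative (\<lambda>v. \<Sum>b\<in>Basis. (fd f p v \<bullet> b) *\<^sub>R fd g (f p) b)) (at p)"
      by metis
  next
    fix v
    have "Ck_on k U (\<lambda>p. fd g (f p) b)" for b
      using Suc.IH[of "\<lambda>x. fd g x b"] Suc.prems(2) Ck_on_SucD[OF Suc.prems(1)] by auto
    moreover have "Ck_on k U (\<lambda>p. fd f p v \<bullet> b)" for b
      by (rule Ck_on_linear[OF bounded_linear_inner_left assms(1)]) (use Suc.prems(1) in simp)
    ultimately show "Ck_on k U (\<lambda>p. \<Sum>b\<in>Basis. (fd f p v \<bullet> b) *\<^sub>R fd g (f p) b)"
      by (intro Ck_on_sum Ck_on_bilinear[OF bounded_bilinear_scaleR] assms)
  qed fact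
qed

section \<open>Closure properties of smooth maps\<close>

lemma smooth_on_cong:
  "open U \<Longrightarrow> (\<And>p. p \<in> U \<Longrightarrow> f p = g p) \<Longrightarrow> smooth_on U f \<longleftrightarrow> smooth_on U g"
  unfolding smooth_on_def using Ck_on_cong by blast

lemma smooth_on_subset: "smooth_on U f \<Longrightarrow> V \<subseteq> U \<Longrightarrow> smooth_on V f"
  unfolding smooth_on_def using Ck_on_subset by blast

lemma smooth_on_has_derivative: "smooth_on U f \<Longrightarrow> p \<in> U \<Longrightarrow> (f has_derivative fd f p) (at p)"
  unfolding smooth_on_def using Ck_on_has_derivative by blast

lemma smooth_on_linear_fd: "smooth_on U f \<Longrightarrow> p \<in> U \<Longrightarrow> linear (fd f p)"
  using smooth_on_has_derivative has_derivative_linear by blast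

lemma smooth_on_continuous_on: "smooth_on U f \<Longrightarrow> continuous_on U f"
  unfolding smooth_on_def using Ck_on.simps(1) by blast

lemma smooth_on_fd_const: "smooth_on U f \<Longrightarrow> smooth_on U (\<lambda>p. fd f p v)"
  unfolding smooth_on_def by (metis Ck_on.simps(2))

lemma smooth_onI:
  assumes "open U" "\<And>p. p \<in> U \<Longrightarrow> (f has_derivative f' p) (at p)"
    and "\<And>v. smooth_on U (\<lambda>p. f' p v)"
  shows "smooth_on U f"
  unfolding smooth_on_def
proof
  fix k
  have "Ck_on k U (\<lambda>p. f' p v)" for v using assms(3) by (simp add: smooth_on_def)
  then show "Ck_on k U f" by (intro Ck_on_SucD[OF Ck_on_SucI[OF assms(1,2)]])
qed

lemma smooth_on_const: "open U \<Longrightarrow> smooth_on U (\<lambda>p. c)"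
  unfolding smooth_on_def by (rule allI, rule Ck_on_const)

lemma smooth_on_linear: "bounded_linear L \<Longrightarrow> open U \<Longrightarrow> smooth_on U f \<Longrightarrow> smooth_on U (\<lambda>p. L (f p))"
  unfolding smooth_on_def by (rule allI, rule Ck_on_linear[of L]) auto

lemma smooth_on_add: "open U \<Longrightarrow> smooth_on U f \<Longrightarrow> smooth_on U g \<Longrightarrow> smooth_on U (\<lambda>p. f p + g p)"
  unfolding smooth_on_def by (rule allI, rule Ck_on_add) auto

lemma smooth_on_sum:
  "open U \<Longrightarrow> (\<And>i. i \<in> I \<Longrightarrow> smooth_on U (f i)) \<Longrightarrow> smooth_on U (\<lambda>p. \<Sum>i\<in>I. f i p)"
  unfolding smooth_on_def by (rule allI, rule Ck_on_sum) auto

lemma smooth_on_bilinear: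
  "bounded_bilinear B \<Longrightarrow> open U \<Longrightarrow> smooth_on U f \<Longrightarrow> smooth_on U g \<Longrightarrow> smooth_on U (\<lambda>p. B (f p) (g p))"
  unfolding smooth_on_def by (rule allI, rule Ck_on_bilinear[of B]) auto

lemma smooth_on_compose:
  fixes g :: "'b::euclidean_space \<Rightarrow> 'c::real_normed_vector"
  shows "open U \<Longrightarrow> open T \<Longrightarrow> f ` U \<subseteq> T \<Longrightarrow> smooth_on U f \<Longrightarrow> smooth_on T g \<Longrightarrow> smooth_on U (\<lambda>p. g (f p))"
  unfolding smooth_on_def by (rule allI, rule Ck_on_compose[where T = T and f = f and g = g]) auto

lemmas smooth_on_scaleR = smooth_on_bilinear[OF bounded_bilinear_scaleR]
lemmas smooth_on_mult = smooth_on_bilinear[OF bounded_bilinear_mult]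
lemmas smooth_on_inner = smooth_on_bilinear[OF bounded_bilinear_inner]
lemmas smooth_on_cross3 =
  smooth_on_bilinear[OF bilinear_cross[unfolded bilinear_conv_bounded_bilinear]]
lemmas smooth_on_minus = smooth_on_linear[OF bounded_linear_minus[OF bounded_linear_ident]]
lemmas smooth_on_fst = smooth_on_linear[OF bounded_linear_fst]
lemmas smooth_on_snd = smooth_on_linear[OF bounded_linear_snd]

lemma smooth_on_ident: "open U \<Longrightarrow> smooth_on U (\<lambda>p. p)"
  by (rule smooth_onI[where f' = "\<lambda>p v. v"]) (auto intro: smooth_on_const)

lemma smooth_on_diff: "open U \<Longrightarrow> smooth_on U f \<Longrightarrow> smooth_on U g \<Longrightarrow> smooth_on U (\<lambda>p. f p - g p)"
  using smooth_on_add[of U f "\<lambda>p. - g p"] smooth_on_minus[of U g] by simp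

lemma smooth_on_Pair:
  fixes f :: "'a::real_normed_vector \<Rightarrow> 'b::real_normed_vector"
    and g :: "'a \<Rightarrow> 'c::real_normed_vector"
  assumes "open U" "smooth_on U f" "smooth_on U g"
  shows "smooth_on U (\<lambda>p. (f p, g p))"
proof -
  have "bounded_linear (\<lambda>x::'b. (x, 0::'c))" "bounded_linear (\<lambda>x::'c. (0::'b, x))"
    by (intro bounded_linear_Pair bounded_linear_ident bounded_linear_zero)+
  then have "smooth_on U (\<lambda>p. (f p, 0) + (0, g p))"
    using assms by (intro smooth_on_add smooth_on_linear[of "\<lambda>x. (x, 0)"] smooth_on_linear[of "Pair 0"])
  then show ?thesis by simp
qed

text \<open>The varying direction \<open>X p\<close> is expanded in the basis, so that only
  derivatives in fixed directions occur.\<close>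

lemma smooth_on_fd:
  fixes f :: "'a::euclidean_space \<Rightarrow> 'b::real_normed_vector"
  assumes "open U" "smooth_on U f" "smooth_on U X"
  shows "smooth_on U (\<lambda>p. fd f p (X p))"
proof -
  have "smooth_on U (\<lambda>p. \<Sum>b\<in>Basis. (X p \<bullet> b) *\<^sub>R fd f p b)"
    using assms by (intro smooth_on_sum smooth_on_scaleR smooth_on_inner smooth_on_const smooth_on_fd_const)
  moreover have "(\<Sum>b\<in>Basis. (X p \<bullet> b) *\<^sub>R fd f p b) = fd f p (X p)" if "p \<in> U" for p
    by (rule linear_eq_sum_Basis[OF smooth_on_linear_fd[OF assms(2) that], symmetric])
  ultimately show ?thesis
    by (subst smooth_on_cong[OF assms(1), where g = "\<lambda>p. \<Sum>b\<in>Basis. (X p \<bullet> b) *\<^sub>R fd f p b"]) simp_all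
qed

section \<open>Reciprocals, square roots, norms and \<open>arccos\<close>\<close>

lemma smooth_on_inverse_nonzero: "smooth_on (- {0}) (inverse :: real \<Rightarrow> real)"
  unfolding smooth_on_def
proof
  fix k show "Ck_on k (- {0}) (inverse :: real \<Rightarrow> real)"
  proof (induction k)
    case (Suc k)
    show ?case
    \<comment> \<open>The derivative is a polynomial in \<open>inverse\<close> itself, so each order
      of differentiability yields the next one.\<close>
    proof (rule Ck_on_SucI[where f' = "\<lambda>p v. - (inverse p * v * inverse p)"])
      show "Ck_on k (- {0}) (\<lambda>p. - (inverse p * v * inverse p))" for v :: real
        by (intro Ck_on_linear[OF bounded_linear_minus[OF bounded_linear_ident]]
              Ck_on_bilinear[OF bounded_bilinear_mult] Suc Ck_on_const) auto
    qed (auto intro: has_derivative_inverse')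
  qed (auto intro: continuous_intros)
qed

lemma smooth_on_inverse:
  fixes f :: "'a::real_normed_vector \<Rightarrow> real"
  assumes "open U" "smooth_on U f" "\<And>p. p \<in> U \<Longrightarrow> f p \<noteq> 0"
  shows "smooth_on U (\<lambda>p. inverse (f p))"
  by (rule smooth_on_compose[OF assms(1) _ _ assms(2) smooth_on_inverse_nonzero]) (use assms(3) in auto)

lemma smooth_on_divide:
  fixes f g :: "'a::real_normed_vector \<Rightarrow> real"
  assumes "open U" "smooth_on U f" "smooth_on U g" "\<And>p. p \<in> U \<Longrightarrow> g p \<noteq> 0"
  shows "smooth_on U (\<lambda>p. f p / g p)"
  unfolding divide_inverse using assms by (intro smooth_on_mult smooth_on_inverse)

lemma smooth_on_sqrt_pos: "smooth_on {0<..} sqrt"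
  unfolding smooth_on_def
proof
  fix k show "Ck_on k {0<..} sqrt"
  proof (induction k)
    case (Suc k)
    show ?case
    proof (rule Ck_on_SucI[where f' = "\<lambda>p v. inverse (sqrt p) * inverse 2 * v"])
      have "Ck_on k {0<..} (\<lambda>p. inverse (sqrt p))"
        by (rule Ck_on_compose[OF _ _ _ Suc, where T = "- {0}"])
          (use smooth_on_inverse_nonzero in \<open>auto simp: smooth_on_def\<close>)
      then show "Ck_on k {0<..} (\<lambda>p. inverse (sqrt p) * inverse 2 * v)" for v
        by (intro Ck_on_bilinear[OF bounded_bilinear_mult] Ck_on_const) auto
      show "(sqrt has_derivative (\<lambda>v. inverse (sqrt p) * inverse 2 * v)) (at p)" if "p \<in> {0<..}" for p
        by (rule has_derivative_eq_rhs[OF DERIV_real_sqrt[unfolded has_field_derivative_def]])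
          (use that in auto)
    qed auto
  qed (auto intro: continuous_intros)
qed

lemma smooth_on_sqrt:
  assumes "open U" "smooth_on U f" "\<And>p. p \<in> U \<Longrightarrow> f p > 0"
  shows "smooth_on U (\<lambda>p. sqrt (f p))"
  by (rule smooth_on_compose[OF assms(1) _ _ assms(2) smooth_on_sqrt_pos]) (use assms(3) in auto)

lemma smooth_on_norm:
  fixes f :: "'a::real_normed_vector \<Rightarrow> 'b::real_inner"
  assumes "open U" "smooth_on U f" "\<And>p. p \<in> U \<Longrightarrow> f p \<noteq> 0"
  shows "smooth_on U (\<lambda>p. norm (f p))"
  unfolding norm_eq_sqrt_inner using assms by (intro smooth_on_sqrt smooth_on_inner) auto

lemma smooth_on_arccos_open: "smooth_on {-1<..<1} arccos"
proof (rule smooth_onI[where f' = "\<lambda>p v. - inverse (sqrt (1 - p * p)) * v"])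
  have pos: "1 - p * p > 0" if "p \<in> {-1<..<1}" for p :: real
    using that abs_square_less_1[of p] by (simp add: power2_eq_square abs_less_iff)
  show "smooth_on {-1<..<1} (\<lambda>p. - inverse (sqrt (1 - p * p)) * v)" for v
    by (intro smooth_on_mult smooth_on_minus smooth_on_inverse smooth_on_sqrt smooth_on_diff
        smooth_on_const smooth_on_ident) (use pos in force)+
  show "(arccos has_derivative (\<lambda>v. - inverse (sqrt (1 - p * p)) * v)) (at p)" if "p \<in> {-1<..<1}" for p
    by (rule has_derivative_eq_rhs[OF DERIV_arccos[unfolded has_field_derivative_def]])
      (use that in \<open>auto simp: power2_eq_square\<close>)
qed auto

lemma smooth_on_arccos:
  assumes "open U" "smooth_on U f" "\<And>p. p \<in> U \<Longrightarrow> \<bar>f p\<bar> < 1"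
  shows "smooth_on U (\<lambda>p. arccos (f p))"
  by (rule smooth_on_compose[OF assms(1) _ _ assms(2) smooth_on_arccos_open])
    (use assms(3) in \<open>force simp: abs_less_iff\<close>)+

section \<open>Second derivatives and Lie brackets\<close>

lemma fd_eqI: "(f has_derivative f') (at p) \<Longrightarrow> fd f p = f'"
  by (rule frechet_derivative_at[symmetric])

lemma smooth_on_DERIV_line:
  fixes f :: "'a::real_normed_vector \<Rightarrow> real"
  assumes "smooth_on U f" "a + s *\<^sub>R v \<in> U"
  shows "((\<lambda>s. f (a + s *\<^sub>R v)) has_real_derivative fd f (a + s *\<^sub>R v) v) (at s)"
proof -
  have line: "((\<lambda>s. a + s *\<^sub>R v) has_derivative (\<lambda>s. s *\<^sub>R v)) (at s)"
    by (auto intro!: derivative_eq_intros)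
  have "((\<lambda>s. f (a + s *\<^sub>R v)) has_derivative (\<lambda>h. fd f (a + s *\<^sub>R v) (h *\<^sub>R v))) (at s)"
    by (rule has_derivative_compose[OF line smooth_on_has_derivative[OF assms]])
  then show ?thesis
    unfolding has_field_derivative_def
    by (rule has_derivative_eq_rhs)
      (simp add: fun_eq_iff linear_cmul[OF smooth_on_linear_fd[OF assms]])
qed

text \<open>The mean value theorem is applied twice: in direction \<open>v\<close> to the difference
  of \<open>f\<close> across \<open>h *\<^sub>R w\<close>, then in direction \<open>w\<close> to the
  resulting first derivative.\<close>

lemma second_difference_mean_value:
  fixes f :: "'a::real_normed_vector \<Rightarrow> real"
  assumes f: "smooth_on U f" and h: "h > 0"
    and U: "\<And>s t. 0 \<le> s \<Longrightarrow> s \<le> h \<Longrightarrow> 0 \<le> t \<Longrightarrow> t \<le> h \<Longrightarrow> p + s *\<^sub>R v + t *\<^sub>R w \<in> U"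
  shows "\<exists>s t. 0 < s \<and> s < h \<and> 0 < t \<and> t < h \<and>
    f (p + h *\<^sub>R v + h *\<^sub>R w) - f (p + h *\<^sub>R v) - f (p + h *\<^sub>R w) + f p =
    h\<^sup>2 * fd (\<lambda>q. fd f q v) (p + s *\<^sub>R v + t *\<^sub>R w) w"
proof -
  have 1: "((\<lambda>s. f (p + h *\<^sub>R w + s *\<^sub>R v) - f (p + s *\<^sub>R v)) has_real_derivative
      fd f (p + h *\<^sub>R w + s *\<^sub>R v) v - fd f (p + s *\<^sub>R v) v) (at s)" if "0 \<le> s" "s \<le> h" for s
    using U[OF that, of h] U[OF that, of 0] h
    by (intro DERIV_diff smooth_on_DERIV_line[OF f]) (auto simp: add_ac)
  obtain s where s: "0 < s" "s < h"
    and eq1: "f (p + h *\<^sub>R w + h *\<^sub>R v) - f (p + h *\<^sub>R v) - (f (p + h *\<^sub>R w + 0 *\<^sub>R v) - f (p + 0 *\<^sub>R v)) =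
      (h - 0) * (fd f (p + h *\<^sub>R w + s *\<^sub>R v) v - fd f (p + s *\<^sub>R v) v)"
    using MVT2[OF h 1] by blast
  have 2: "((\<lambda>t. fd f (p + s *\<^sub>R v + t *\<^sub>R w) v) has_real_derivative
      fd (\<lambda>q. fd f q v) (p + s *\<^sub>R v + t *\<^sub>R w) w) (at t)" if "0 \<le> t" "t \<le> h" for t
    using smooth_on_DERIV_line[OF smooth_on_fd_const[OF f, of v], of "p + s *\<^sub>R v" t w] U[of s t] s that
    by simp
  obtain t where t: "0 < t" "t < h"
    and eq2: "fd f (p + s *\<^sub>R v + h *\<^sub>R w) v - fd f (p + s *\<^sub>R v + 0 *\<^sub>R w) v =
      (h - 0) * fd (\<lambda>q. fd f q v) (p + s *\<^sub>R v + t *\<^sub>R w) w"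
    using MVT2[OF h 2] by blast
  have "p + h *\<^sub>R w + s *\<^sub>R v = p + s *\<^sub>R v + h *\<^sub>R w" "p + h *\<^sub>R w + h *\<^sub>R v = p + h *\<^sub>R v + h *\<^sub>R w"
    by (simp_all add: add_ac)
  then show ?thesis
    using s t eq1 eq2 by (intro exI[of _ s] exI[of _ t]) (simp add: power2_eq_square algebra_simps)
qed

text \<open>The second difference is unchanged when \<open>v\<close> and \<open>w\<close> are
  swapped. Hence the two mixed derivatives take equal values at two points as near to
  \<open>p\<close> as desired, and by continuity they agree at \<open>p\<close>.\<close>

lemma second_derivative_symmetric_real:
  fixes f :: "'a::real_normed_vector \<Rightarrow> real"
  assumes "open U" and f: "smooth_on U f" and "p \<in> U"
  shows "fd (\<lambda>q. fd f q v) p w = fd (\<lambda>q. fd f q w) p v"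
proof (rule ccontr)
  define A where "A = (\<lambda>q. fd (\<lambda>q. fd f q v) q w)"
  define B where "B = (\<lambda>q. fd (\<lambda>q. fd f q w) q v)"
  assume "\<not> ?thesis"
  then have "dist (A p) (B p) / 2 > 0" by (simp add: A_def B_def)
  moreover have "continuous_on U A" "continuous_on U B"
    unfolding A_def B_def by (intro smooth_on_continuous_on smooth_on_fd_const f)+
  ultimately obtain a b where a: "a > 0" "\<And>q. q \<in> U \<Longrightarrow> dist q p < a \<Longrightarrow> dist (A q) (A p) < dist (A p) (B p) / 2"
    and b: "b > 0" "\<And>q. q \<in> U \<Longrightarrow> dist q p < b \<Longrightarrow> dist (B q) (B p) < dist (A p) (B p) / 2"
    unfolding continuous_on_iff using \<open>p \<in> U\<close> by metis
  obtain e where e: "e > 0" "ball p e \<subseteq> U" using assms by (meson openE)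
  define d where "d = Min {a, b, e}"
  have d: "d > 0" "d \<le> a" "d \<le> b" "d \<le> e" using a b e by (auto simp: d_def)
  \<comment> \<open>Small enough for the parallelogram to stay within distance \<open>d\<close> of
    \<open>p\<close>; the summand 1 keeps the denominator positive when both directions
    vanish.\<close>
  define h where "h = d / (norm v + norm w + 1)"
  have n: "norm v + norm w + 1 > 0" by (smt (verit) norm_ge_zero)
  then have h: "h > 0" using d by (simp add: h_def)
  have near: "dist (p + s *\<^sub>R x + t *\<^sub>R y) p < d"
    if "0 \<le> s" "s \<le> h" "0 \<le> t" "t \<le> h" "{x, y} = {v, w}" for s t x y
  proof -
    have "dist (p + s *\<^sub>R x + t *\<^sub>R y) p \<le> s * norm x + t * norm y"
      using that norm_triangle_ineq[of "s *\<^sub>R x" "t *\<^sub>R y"] by (simp add: dist_norm add.assoc)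
    also have "\<dots> \<le> h * norm x + h * norm y"
      using that by (intro add_mono mult_right_mono) auto
    also have "\<dots> = h * (norm v + norm w)"
      using that(5) by (auto simp: doubleton_eq_iff algebra_simps)
    also have "\<dots> < h * (norm v + norm w + 1)" using h by simp
    also have "\<dots> = d" using n by (simp add: h_def)
    finally show ?thesis .
  qed
  have inU: "p + s *\<^sub>R x + t *\<^sub>R y \<in> U"
    if "0 \<le> s" "s \<le> h" "0 \<le> t" "t \<le> h" "{x, y} = {v, w}" for s t x y
    using near[OF that] d(4) e(2) by (auto simp: dist_commute subset_iff)
  obtain s t where st: "0 < s" "s < h" "0 < t" "t < h"
    and 1: "f (p + h *\<^sub>R v + h *\<^sub>R w) - f (p + h *\<^sub>R v) - f (p + h *\<^sub>R w) + f p =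
      h\<^sup>2 * A (p + s *\<^sub>R v + t *\<^sub>R w)"
    using second_difference_mean_value[OF f h inU, of v w] unfolding A_def by auto
  obtain s' t' where st': "0 < s'" "s' < h" "0 < t'" "t' < h"
    and 2: "f (p + h *\<^sub>R w + h *\<^sub>R v) - f (p + h *\<^sub>R w) - f (p + h *\<^sub>R v) + f p =
      h\<^sup>2 * B (p + s' *\<^sub>R w + t' *\<^sub>R v)"
    using second_difference_mean_value[OF f h inU, of w v] unfolding B_def by (auto simp: insert_commute)
  have "p + h *\<^sub>R w + h *\<^sub>R v = p + h *\<^sub>R v + h *\<^sub>R w" by (simp add: add_ac)
  with 1 2 have "h\<^sup>2 * A (p + s *\<^sub>R v + t *\<^sub>R w) = h\<^sup>2 * B (p + s' *\<^sub>R w + t' *\<^sub>R v)"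
    by (simp add: algebra_simps)
  then have "A (p + s *\<^sub>R v + t *\<^sub>R w) = B (p + s' *\<^sub>R w + t' *\<^sub>R v)" using h by simp
  moreover have "dist (A (p + s *\<^sub>R v + t *\<^sub>R w)) (A p) < dist (A p) (B p) / 2"
    using near[of s t v w] inU[of s t v w] st d by (intro a) auto
  moreover have "dist (B (p + s' *\<^sub>R w + t' *\<^sub>R v)) (B p) < dist (A p) (B p) / 2"
    using near[of s' t' w v] inU[of s' t' w v] st' d by (intro b) (auto simp: insert_commute)
  ultimately show False
    by (metis dist_commute dist_triangle_half_l less_irrefl)
qed

lemma fd_inner_const:
  assumes "smooth_on U f" "p \<in> U"
  shows "fd (\<lambda>q. f q \<bullet> c) p v = fd f p v \<bullet> c"
  by (subst fd_eqI[OF has_derivative_inner_left[OF smooth_on_has_derivative[OF assms]]]) simp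

text \<open>Inner products with constant vectors reduce this to the real-valued case.\<close>

lemma second_derivative_symmetric:
  fixes f :: "'a::real_normed_vector \<Rightarrow> 'b::real_inner"
  assumes "open U" "smooth_on U f" "p \<in> U"
  shows "fd (\<lambda>q. fd f q v) p w = fd (\<lambda>q. fd f q w) p v"
proof -
  have *: "fd (\<lambda>q. fd f q v) p w \<bullet> c = fd (\<lambda>q. fd (\<lambda>q. f q \<bullet> c) q v) p w" for c v w
  proof -
    have "fd (\<lambda>q. fd f q v) p w \<bullet> c = fd (\<lambda>q. fd f q v \<bullet> c) p w"
      by (rule fd_inner_const[OF smooth_on_fd_const[OF assms(2)] assms(3), symmetric])
    also have "\<dots> = fd (\<lambda>q. fd (\<lambda>q. f q \<bullet> c) q v) p w"
      by (subst frechet_derivative_cong_open[OF assms(1,3)]) (auto simp: fd_inner_const[OF assms(2)])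
    finally show ?thesis .
  qed
  have "smooth_on U (\<lambda>q. f q \<bullet> c)" for c
    by (intro smooth_on_inner smooth_on_const assms)
  then show ?thesis
    using second_derivative_symmetric_real[OF assms(1) _ assms(3)] *
    by (metis vector_eq_rdot)
qed

text \<open>After expansion in the basis the ordinary product rule applies. Applying the result to
  the constant field \<open>X p\<close> as well identifies the part in which only \<open>A\<close>
  is differentiated.\<close>

lemma has_derivative_linear_field:
  fixes A :: "'a::euclidean_space \<Rightarrow> 'b::euclidean_space \<Rightarrow> 'c::real_normed_vector"
  assumes "open U" and lin: "\<And>q. q \<in> U \<Longrightarrow> linear (A q)" and A: "\<And>v. smooth_on U (\<lambda>q. A q v)"
    and X: "smooth_on U X" and p: "p \<in> U"
  shows "((\<lambda>q. A q (X q)) has_derivative (\<lambda>v. fd (\<lambda>q. A q (X p)) p v + A p (fd X p v))) (at p)"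
proof -
  have gen: "((\<lambda>q. A q (Y q)) has_derivative
      (\<lambda>v. \<Sum>b\<in>Basis. (Y p \<bullet> b) *\<^sub>R fd (\<lambda>q. A q b) p v + (fd Y p v \<bullet> b) *\<^sub>R A p b)) (at p)"
    if Y: "smooth_on U Y" for Y
  proof (subst has_derivative_cong_open[OF assms(1) p])
    show "A q (Y q) = (\<Sum>b\<in>Basis. (Y q \<bullet> b) *\<^sub>R A q b)" if "q \<in> U" for q
      by (rule linear_eq_sum_Basis[OF lin[OF that]])
    show "((\<lambda>q. \<Sum>b\<in>Basis. (Y q \<bullet> b) *\<^sub>R A q b) has_derivative
      (\<lambda>v. \<Sum>b\<in>Basis. (Y p \<bullet> b) *\<^sub>R fd (\<lambda>q. A q b) p v + (fd Y p v \<bullet> b) *\<^sub>R A p b)) (at p)"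
      by (intro has_derivative_sum has_derivative_scaleR has_derivative_inner_left
          smooth_on_has_derivative[OF A p] smooth_on_has_derivative[OF Y p])
  qed
  have "fd (\<lambda>q. A q (X p)) p v = (\<Sum>b\<in>Basis. (X p \<bullet> b) *\<^sub>R fd (\<lambda>q. A q b) p v)" for v
    by (subst fd_eqI[OF gen[OF smooth_on_const[OF assms(1), of "X p"]]]) simp
  moreover have "A p (fd X p v) = (\<Sum>b\<in>Basis. (fd X p v \<bullet> b) *\<^sub>R A p b)" for v
    by (rule linear_eq_sum_Basis[OF lin[OF p]])
  ultimately have "(\<lambda>v. \<Sum>b\<in>Basis. (X p \<bullet> b) *\<^sub>R fd (\<lambda>q. A q b) p v + (fd X p v \<bullet> b) *\<^sub>R A p b) =
      (\<lambda>v. fd (\<lambda>q. A q (X p)) p v + A p (fd X p v))"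
    by (simp only: sum.distrib)
  with gen[OF X] show ?thesis by simp
qed

lemma linear_fd_linear_field:
  fixes A :: "'a::real_normed_vector \<Rightarrow> 'b::real_vector \<Rightarrow> 'c::real_normed_vector"
  assumes "open U" and lin: "\<And>q. q \<in> U \<Longrightarrow> linear (A q)" and A: "\<And>v. smooth_on U (\<lambda>q. A q v)"
    and p: "p \<in> U"
  shows "linear (\<lambda>v. fd (\<lambda>q. A q v) p w)"
proof (rule linearI)
  note d = smooth_on_has_derivative[OF A p]
  show "fd (\<lambda>q. A q (x + y)) p w = fd (\<lambda>q. A q x) p w + fd (\<lambda>q. A q y) p w" for x y
  proof -
    have "fd (\<lambda>q. A q (x + y)) p = fd (\<lambda>q. A q x + A q y) p"
      by (rule frechet_derivative_cong_open[OF assms(1) p]) (simp add: linear_add[OF lin])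
    then show ?thesis by (simp add: fd_eqI[OF has_derivative_add[OF d d]])
  qed
  show "fd (\<lambda>q. A q (c *\<^sub>R x)) p w = c *\<^sub>R fd (\<lambda>q. A q x) p w" for c x
  proof -
    have "fd (\<lambda>q. A q (c *\<^sub>R x)) p = fd (\<lambda>q. c *\<^sub>R A q x) p"
      by (rule frechet_derivative_cong_open[OF assms(1) p]) (simp add: linear_cmul[OF lin])
    then show ?thesis by (simp add: fd_eqI[OF has_derivative_scaleR_right[OF d]])
  qed
qed

lemma fd_vf_deriv:
  fixes f :: "'a::euclidean_space \<Rightarrow> 'b::real_normed_vector"
  assumes "open U" "smooth_on U f" "smooth_on U X" "p \<in> U"
  shows "fd (vf_deriv X f) p v = fd (\<lambda>q. fd f q (X p)) p v + fd f p (fd X p v)"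
  unfolding vf_deriv_def
  by (rule fun_cong[OF fd_eqI[OF has_derivative_linear_field[OF assms(1) _ _ assms(3,4)]]])
    (use assms smooth_on_linear_fd smooth_on_fd_const in blast)+

text \<open>With this sign the bracket acts on functions as X(Yf) - Y(Xf).\<close>

definition lie_bracket :: "('a::real_normed_vector \<Rightarrow> 'a) \<Rightarrow> ('a \<Rightarrow> 'a) \<Rightarrow> 'a \<Rightarrow> 'a" where
  "lie_bracket X Y p = fd Y p (X p) - fd X p (Y p)"

text \<open>The second derivatives of \<open>f\<close> cancel by symmetry; what remains comes from
  differentiating the fields.\<close>

lemma vf_deriv_lie_bracket:
  fixes f :: "'a::euclidean_space \<Rightarrow> 'b::real_inner"
  assumes "open U" "smooth_on U f" "smooth_on U X" "smooth_on U Y" "p \<in> U"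
  shows "vf_deriv X (vf_deriv Y f) p = vf_deriv Y (vf_deriv X f) p + fd f p (lie_bracket X Y p)"
proof -
  have "vf_deriv X (vf_deriv Y f) p = fd (\<lambda>q. fd f q (Y p)) p (X p) + fd f p (fd Y p (X p))"
    using fd_vf_deriv[OF assms(1,2,4,5)] by (simp add: vf_deriv_def)
  moreover have "vf_deriv Y (vf_deriv X f) p = fd (\<lambda>q. fd f q (X p)) p (Y p) + fd f p (fd X p (Y p))"
    using fd_vf_deriv[OF assms(1,2,3,5)] by (simp add: vf_deriv_def)
  ultimately show ?thesis
    using second_derivative_symmetric[OF assms(1,2,5), of "X p" "Y p"]
    by (simp add: lie_bracket_def linear_diff[OF smooth_on_linear_fd[OF assms(2,5)]])
qed

section \<open>Closed forms and commuting frames\<close>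

text \<open>The primitive is the integral of the form along the segment from a base point
  \<open>z\<close> to \<open>p\<close>. Closedness turns the derivative of the integrand in
  direction \<open>v\<close> into the \<open>t\<close>-derivative of
  \<open>t * \<omega> (c p t) v\<close>, so that integration returns
  \<open>\<omega> p v\<close>.\<close>

lemma poincare_closed_form:
  fixes \<omega> :: "'a::euclidean_space \<Rightarrow> 'a \<Rightarrow> real"
  assumes "open U" "convex U"
    and lin: "\<And>q. q \<in> U \<Longrightarrow> linear (\<omega> q)" and smooth: "\<And>v. smooth_on U (\<lambda>q. \<omega> q v)"
    and closed: "\<And>q v w. q \<in> U \<Longrightarrow> fd (\<lambda>q. \<omega> q v) q w = fd (\<lambda>q. \<omega> q w) q v"
  shows "\<exists>f. \<forall>p\<in>U. (f has_derivative \<omega> p) (at p)"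
proof (cases "U = {}")
  case False
  then obtain z where z: "z \<in> U" by blast
  define c where "c = (\<lambda>p t. z + t *\<^sub>R (p - z))"
  define I :: "real set" where "I = cbox 0 1"
  have cU: "c p t \<in> U" if "p \<in> U" "t \<in> I" for p t
    using that convexD_alt[OF \<open>convex U\<close> z \<open>p \<in> U\<close>, of t] by (simp add: c_def I_def algebra_simps)
  \<comment> \<open>The derivative of the integrand \<open>F\<close> below, written in the form that
    it takes once closedness has exchanged \<open>v\<close> and \<open>p - z\<close>.\<close>
  define G where "G = (\<lambda>p t v. \<omega> (c p t) v + t * fd (\<lambda>q. \<omega> q v) (c p t) (p - z))"
  define F where "F = (\<lambda>p t. \<omega> (c p t) (p - z))"
  have lin2: "linear (\<lambda>v. fd (\<lambda>q. \<omega> q v) q w)" if "q \<in> U" for q w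
    by (rule linear_fd_linear_field[OF assms(1) lin smooth that])
  have linG: "linear (G p t)" if "p \<in> U" "t \<in> I" for p t
    unfolding G_def
    using linear_compose_add[OF lin[OF cU[OF that]]
        linear_compose_scale_right[OF lin2[OF cU[OF that], of "p - z"], of t]] by simp
  have contc: "continuous_on (U \<times> I) (\<lambda>(p, t). c p t)"
    unfolding c_def split_beta by (intro continuous_intros)
  have cont_comp: "continuous_on (U \<times> I) (\<lambda>(p, t). g (c p t))" if "continuous_on U g" for g :: "'a \<Rightarrow> real"
    unfolding split_beta
    by (rule continuous_on_compose2[OF that contc[unfolded split_beta]]) (use cU in auto)
  have smooth': "smooth_on U (\<lambda>q. fd (\<lambda>q. \<omega> q v) q w)" for v w
    by (rule smooth_on_fd_const[OF smooth])
  have cont_fd: "continuous_on (U \<times> I) (\<lambda>(p, t). fd (\<lambda>q. \<omega> q v) (c p t) (p - z))" for v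
  proof -
    have "continuous_on (U \<times> I) (\<lambda>x. \<Sum>b\<in>Basis. ((fst x - z) \<bullet> b) *\<^sub>R fd (\<lambda>q. \<omega> q v) (c (fst x) (snd x)) b)"
      using cont_comp[OF smooth_on_continuous_on[OF smooth']]
      by (intro continuous_intros) (simp add: split_beta)
    moreover have "(\<lambda>(p, t). fd (\<lambda>q. \<omega> q v) (c p t) (p - z)) x =
        (\<Sum>b\<in>Basis. ((fst x - z) \<bullet> b) *\<^sub>R fd (\<lambda>q. \<omega> q v) (c (fst x) (snd x)) b)" if "x \<in> U \<times> I" for x
      using linear_eq_sum_Basis[OF smooth_on_linear_fd[OF smooth cU], of "fst x" "snd x" v "fst x - z"] that
      by (auto simp: split_beta)
    ultimately show ?thesis by (subst continuous_on_cong[OF refl]) auto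
  qed
  have contG: "continuous_on (U \<times> I) (\<lambda>(p, t). G p t v)" for v
    using cont_comp[OF smooth_on_continuous_on[OF smooth], of v] cont_fd[of v]
    unfolding G_def split_beta by (intro continuous_intros) auto
  have derF: "((\<lambda>p. F p t) has_derivative G p t) (at p)" if p: "p \<in> U" and t: "t \<in> I" for p t
  proof -
    have dc: "((\<lambda>p. c p t) has_derivative (\<lambda>v. t *\<^sub>R v)) (at p)"
      unfolding c_def by (auto intro!: derivative_eq_intros)
    have d1: "((\<lambda>p. \<omega> (c p t) b) has_derivative (\<lambda>v. fd (\<lambda>q. \<omega> q b) (c p t) (t *\<^sub>R v))) (at p)" for b
      by (rule has_derivative_compose[OF dc smooth_on_has_derivative[OF smooth[of b] cU[OF p t]]])
    have d2: "((\<lambda>p. (p - z) \<bullet> b) has_derivative (\<lambda>v. v \<bullet> b)) (at p)" for b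
      by (auto intro!: derivative_eq_intros)
    \<comment> \<open>The basis expansion of \<open>F q t\<close> needs \<open>c q t\<close> to lie
      in \<open>U\<close>; this holds on an open set around \<open>p\<close>.\<close>
    define N where "N = (\<lambda>p. c p t) -` U"
    have "open N" unfolding N_def c_def
      using \<open>open U\<close> by (intro open_vimage continuous_intros)
    have "p \<in> N" using cU[OF p t] by (simp add: N_def)
    have "((\<lambda>p. \<Sum>b\<in>Basis. ((p - z) \<bullet> b) *\<^sub>R \<omega> (c p t) b) has_derivative
        (\<lambda>v. \<Sum>b\<in>Basis. ((p - z) \<bullet> b) *\<^sub>R fd (\<lambda>q. \<omega> q b) (c p t) (t *\<^sub>R v) + (v \<bullet> b) *\<^sub>R \<omega> (c p t) b)) (at p)"
      by (intro has_derivative_sum has_derivative_scaleR d1 d2)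
    moreover have "(\<Sum>b\<in>Basis. ((p - z) \<bullet> b) *\<^sub>R fd (\<lambda>q. \<omega> q b) (c p t) (t *\<^sub>R v) + (v \<bullet> b) *\<^sub>R \<omega> (c p t) b) = G p t v" for v
    proof -
      have "fd (\<lambda>q. \<omega> q b) (c p t) (t *\<^sub>R v) = t * fd (\<lambda>q. \<omega> q v) (c p t) b" for b
        using closed[OF cU[OF p t]] linear_cmul[OF smooth_on_linear_fd[OF smooth cU[OF p t]]] by simp
      then show ?thesis
        using linear_eq_sum_Basis[OF lin[OF cU[OF p t]], of v]
          linear_eq_sum_Basis[OF smooth_on_linear_fd[OF smooth[of v] cU[OF p t]], of "p - z"]
        by (simp add: G_def sum.distrib sum_distrib_left mult_ac)
    qed
    moreover have "F q t = (\<Sum>b\<in>Basis. ((q - z) \<bullet> b) *\<^sub>R \<omega> (c q t) b)" if "q \<in> N" for q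
      unfolding F_def using that by (intro linear_eq_sum_Basis lin) (simp add: N_def)
    ultimately show ?thesis
      by (subst has_derivative_cong_open[OF \<open>open N\<close> \<open>p \<in> N\<close>]) auto
  qed
  \<comment> \<open>\<open>leibniz_rule\<close> expects the derivatives as elements of the normed
    space of bounded linear maps, depending continuously on point and parameter.\<close>
  define fx where "fx = (\<lambda>p t. Blinfun (G p t))"
  have fx: "blinfun_apply (fx p t) = G p t" if "p \<in> U" "t \<in> I" for p t
    unfolding fx_def using linG[OF that] by (simp add: bounded_linear_Blinfun_apply linear_conv_bounded_linear)
  have cont_fx: "continuous_on (U \<times> I) (\<lambda>(p, t). fx p t)"
  proof (rule continuous_on_blinfun_componentwise)
    fix b :: 'a
    show "continuous_on (U \<times> I) (\<lambda>x. blinfun_apply (case x of (p, t) \<Rightarrow> fx p t) b)"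
      using contG[of b] by (subst continuous_on_cong[OF refl]) (auto simp: fx)
  qed
  have int_fx: "fx p integrable_on I" if "p \<in> U" for p
    unfolding I_def
  proof (rule integrable_continuous)
    show "continuous_on (cbox 0 1) (fx p)"
      using continuous_on_compose2[OF cont_fx, of I "\<lambda>t. (p, t)"] that
      by (auto simp: I_def continuous_on_Pair)
  qed
  have "((\<lambda>p. integral I (F p)) has_derivative \<omega> p) (at p)" if p: "p \<in> U" for p
  proof -
    have "((\<lambda>p. integral I (F p)) has_derivative integral I (fx p)) (at p within U)"
      unfolding I_def
    proof (rule leibniz_rule[OF _ _ _ p \<open>convex U\<close>])
      show "((\<lambda>p. F p t) has_derivative fx p t) (at p within U)" if "p \<in> U" "t \<in> cbox 0 1" for p t
        using derF fx that by (auto simp: I_def intro: has_derivative_at_withinI)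
      show "F p integrable_on cbox 0 1" if "p \<in> U" for p
      proof (rule integrable_continuous)
        have "continuous_on I (\<lambda>t. \<Sum>b\<in>Basis. ((p - z) \<bullet> b) *\<^sub>R \<omega> (c p t) b)"
          using that cU
          by (intro continuous_intros continuous_on_compose2[OF smooth_on_continuous_on[OF smooth]])
            (auto simp: c_def intro!: continuous_intros)
        moreover have "F p t = (\<Sum>b\<in>Basis. ((p - z) \<bullet> b) *\<^sub>R \<omega> (c p t) b)" if "t \<in> I" for t
          unfolding F_def by (intro linear_eq_sum_Basis lin cU \<open>p \<in> U\<close> that)
        ultimately show "continuous_on (cbox 0 1) (F p)"
          unfolding I_def by (subst continuous_on_cong[OF refl]) auto
      qed
      show "continuous_on (U \<times> cbox 0 1) (\<lambda>(p, t). fx p t)" using cont_fx by (simp add: I_def)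
    qed
    moreover have "blinfun_apply (integral I (fx p)) v = \<omega> p v" for v
    proof -
      \<comment> \<open>This antiderivative vanishes at 0 because of the factor \<open>t\<close>,
        and at 1 it equals \<open>\<omega> p v\<close> because \<open>c p 1 = p\<close>.\<close>
      have "((\<lambda>t. t * \<omega> (c p t) v) has_real_derivative G p t v) (at t)" if t: "t \<in> I" for t
      proof -
        have "((\<lambda>t. \<omega> (z + t *\<^sub>R (p - z)) v) has_real_derivative fd (\<lambda>q. \<omega> q v) (c p t) (p - z)) (at t)"
          using smooth_on_DERIV_line[OF smooth, of z t "p - z" v] cU[OF p t] by (simp add: c_def)
        from DERIV_mult[OF DERIV_ident this] show ?thesis
          by (simp add: G_def c_def add.commute mult.commute)
      qed
      then have "((\<lambda>t. G p t v) has_integral (1 * \<omega> (c p 1) v - 0 * \<omega> (c p 0) v)) {0..1}"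
        by (intro fundamental_theorem_of_calculus)
          (auto simp: I_def has_real_derivative_iff_has_vector_derivative[symmetric]
            intro: has_field_derivative_at_within)
      then have "integral I (\<lambda>t. G p t v) = \<omega> p v"
        by (simp add: I_def c_def integral_unique)
      moreover have "integral I (\<lambda>t. blinfun_apply (fx p t) v) = integral I (\<lambda>t. G p t v)"
        by (rule integral_cong) (simp add: fx p)
      ultimately show ?thesis
        by (simp add: blinfun_apply_integral[OF int_fx[OF p]])
    qed
    ultimately show ?thesis
      using at_within_open[OF p \<open>open U\<close>] by (metis ext)
  qed
  then show ?thesis by blast
qed auto

section \<open>Frames in the parameter plane and their dual coframes\<close>

lemma net_on_det:
  fixes X Y :: "real \<times> real \<Rightarrow> real \<times> real"
  assumes "net_on U X Y" "p \<in> U"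
  shows "fst (X p) * snd (Y p) - snd (X p) * fst (Y p) \<noteq> 0"
proof
  assume det: "fst (X p) * snd (Y p) - snd (X p) * fst (Y p) = 0"
  have *: "\<And>a b. a *\<^sub>R X p + b *\<^sub>R Y p = 0 \<Longrightarrow> a = 0 \<and> b = 0"
    using assms by (auto simp: net_on_def)
  have "snd (Y p) *\<^sub>R X p + (- snd (X p)) *\<^sub>R Y p = 0" "fst (Y p) *\<^sub>R X p + (- fst (X p)) *\<^sub>R Y p = 0"
    using det by (auto simp: prod_eq_iff algebra_simps)
  then have "snd (X p) = 0" "fst (X p) = 0" using * by fastforce+
  then have "1 *\<^sub>R X p + 0 *\<^sub>R Y p = 0" by (simp add: prod_eq_iff)
  then show False using *[of 1 0] by simp
qed

lemma net_on_expand: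
  fixes X Y :: "real \<times> real \<Rightarrow> real \<times> real"
  assumes "net_on U X Y" "p \<in> U"
  obtains a b where "v = a *\<^sub>R X p + b *\<^sub>R Y p"
proof
  define d where "d = fst (X p) * snd (Y p) - snd (X p) * fst (Y p)"
  have d: "d \<noteq> 0" using net_on_det[OF assms] by (simp add: d_def)
  \<comment> \<open>Cramer's rule.\<close>
  show "v = ((fst v * snd (Y p) - snd v * fst (Y p)) / d) *\<^sub>R X p +
      ((snd v * fst (X p) - fst v * snd (X p)) / d) *\<^sub>R Y p"
    using d by (simp add: prod_eq_iff field_simps) (simp add: d_def algebra_simps)
qed

text \<open>Since the form is constant on \<open>X\<close> and on \<open>Y\<close>, differentiating
  these constants along \<open>Y\<close> and \<open>X\<close> expresses the exterior derivative on
  the frame through the form's value at the bracket, which is 0. In dimension two the frame is all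
  that has to be tested.\<close>

lemma closed_form_of_commuting_frame:
  fixes X Y :: "real \<times> real \<Rightarrow> real \<times> real" and \<omega> :: "real \<times> real \<Rightarrow> real \<times> real \<Rightarrow> real"
  assumes "open U" and net: "net_on U X Y"
    and lin: "\<And>q. q \<in> U \<Longrightarrow> linear (\<omega> q)" and smooth: "\<And>v. smooth_on U (\<lambda>q. \<omega> q v)"
    and const: "\<And>q. q \<in> U \<Longrightarrow> \<omega> q (X q) = a" "\<And>q. q \<in> U \<Longrightarrow> \<omega> q (Y q) = b"
    and lie: "lie_bracket X Y p = 0" and p: "p \<in> U"
  shows "fd (\<lambda>q. \<omega> q v) p w = fd (\<lambda>q. \<omega> q w) p v"
proof -
  \<comment> \<open>\<open>C v w\<close> differentiates along \<open>v\<close> with the argument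
    \<open>w\<close> of the form frozen. It is bilinear, and closedness at \<open>p\<close> is its
    symmetry.\<close>
  define C where "C = (\<lambda>v w. fd (\<lambda>q. \<omega> q w) p v)"
  have zero: "C v (Z p) + \<omega> p (fd Z p v) = 0"
    if Z: "smooth_on U Z" and c: "\<And>q. q \<in> U \<Longrightarrow> \<omega> q (Z q) = c" for Z c v
  proof -
    have "fd (\<lambda>q. \<omega> q (Z q)) p v = C v (Z p) + \<omega> p (fd Z p v)"
      unfolding C_def by (rule fun_cong[OF fd_eqI[OF has_derivative_linear_field[OF assms(1) lin smooth Z p]]])
    moreover have "fd (\<lambda>q. \<omega> q (Z q)) p = fd (\<lambda>q. c) p"
      by (rule frechet_derivative_cong_open[OF assms(1) p c])
    ultimately show ?thesis by simp
  qed
  have X: "smooth_on U X" and Y: "smooth_on U Y" using net by (auto simp: net_on_def)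
  have "fd X p (Y p) = fd Y p (X p)" using lie by (simp add: lie_bracket_def)
  then have sym: "C (Y p) (X p) = C (X p) (Y p)"
    using zero[OF X const(1), of "Y p"] zero[OF Y const(2), of "X p"] by simp
  have lin1: "linear (\<lambda>v. C v w)" for w
    unfolding C_def using smooth_on_linear_fd[OF smooth p] by simp
  have lin2: "linear (C v)" for v
    unfolding C_def by (rule linear_fd_linear_field[OF assms(1) lin smooth p])
  obtain v1 v2 w1 w2 where v: "v = v1 *\<^sub>R X p + v2 *\<^sub>R Y p" and w: "w = w1 *\<^sub>R X p + w2 *\<^sub>R Y p"
    using net_on_expand[OF net p, of v] net_on_expand[OF net p, of w] by metis
  have "C v w = C w v"
    unfolding v w using sym
    by (simp add: linear_add[OF lin1] linear_add[OF lin2] linear_cmul[OF lin1] linear_cmul[OF lin2] algebra_simps)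
  then show ?thesis by (simp add: C_def)
qed

text \<open>The forms of the dual coframe are closed, and their primitives on a ball are the
  coordinate functions. Together they form a map whose derivative sends the frame to the standard
  basis; its local inverse is the required parametrization.\<close>

lemma commuting_frame_coordinates:
  fixes X Y :: "real \<times> real \<Rightarrow> real \<times> real"
  assumes "open U" and net: "net_on U X Y"
    and lie: "\<And>q. q \<in> U \<Longrightarrow> lie_bracket X Y q = 0" and p: "p \<in> U"
  obtains V W and \<phi> \<psi> :: "real \<times> real \<Rightarrow> real \<times> real" where "open V" "p \<in> V" "V \<subseteq> U" "open W" "homeomorphism W V \<phi> \<psi>"
    "smooth_on W \<phi>" "smooth_on V \<psi>"
    "\<And>q. q \<in> W \<Longrightarrow> fd \<phi> q (1,0) = X (\<phi> q)" "\<And>q. q \<in> W \<Longrightarrow> fd \<phi> q (0,1) = Y (\<phi> q)"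
proof -
  have X: "smooth_on U X" and Y: "smooth_on U Y" using net by (auto simp: net_on_def)
  define d where "d = (\<lambda>q. fst (X q) * snd (Y q) - snd (X q) * fst (Y q))"
  have d: "d q \<noteq> 0" if "q \<in> U" for q using net_on_det[OF net that] by (simp add: d_def)
  \<comment> \<open>The dual coframe, given by the coefficients of Cramer's rule.\<close>
  define \<omega>1 where "\<omega>1 = (\<lambda>q v. (fst v * snd (Y q) - snd v * fst (Y q)) / d q)"
  define \<omega>2 where "\<omega>2 = (\<lambda>q v. (snd v * fst (X q) - fst v * snd (X q)) / d q)"
  have lin: "linear (\<omega>1 q)" "linear (\<omega>2 q)" for q
    unfolding \<omega>1_def \<omega>2_def by (auto intro!: linearI simp: algebra_simps add_divide_distrib diff_divide_distrib)
  have smooth: "smooth_on U (\<lambda>q. \<omega>1 q v)" "smooth_on U (\<lambda>q. \<omega>2 q v)" for v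
    unfolding \<omega>1_def \<omega>2_def d_def
    by (intro smooth_on_divide smooth_on_diff smooth_on_mult smooth_on_const smooth_on_fst smooth_on_snd
        X Y \<open>open U\<close>; use d in \<open>simp add: d_def\<close>)+
  have vals: "\<omega>1 q (X q) = 1" "\<omega>1 q (Y q) = 0" "\<omega>2 q (X q) = 0" "\<omega>2 q (Y q) = 1" if "q \<in> U" for q
    using d[OF that] by (auto simp: \<omega>1_def \<omega>2_def d_def mult.commute)
  obtain e where e: "e > 0" "ball p e \<subseteq> U" using \<open>open U\<close> p by (meson openE)
  define B where "B = ball p e"
  have B: "open B" "convex B" "B \<subseteq> U" "p \<in> B" using e by (auto simp: B_def)
  have "\<exists>f. \<forall>q\<in>B. (f has_derivative \<omega>1 q) (at q)"
  proof (rule poincare_closed_form[OF B(1,2)])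
    show "fd (\<lambda>q. \<omega>1 q v) q w = fd (\<lambda>q. \<omega>1 q w) q v" if "q \<in> B" for q v w
      using that B(3) by (intro closed_form_of_commuting_frame[OF \<open>open U\<close> net lin(1) smooth(1) vals(1,2) lie]) auto
  qed (use lin smooth_on_subset[OF smooth(1) B(3)] in auto)
  then obtain f1 where f1: "\<And>q. q \<in> B \<Longrightarrow> (f1 has_derivative \<omega>1 q) (at q)" by blast
  have "\<exists>f. \<forall>q\<in>B. (f has_derivative \<omega>2 q) (at q)"
  proof (rule poincare_closed_form[OF B(1,2)])
    show "fd (\<lambda>q. \<omega>2 q v) q w = fd (\<lambda>q. \<omega>2 q w) q v" if "q \<in> B" for q v w
      using that B(3) by (intro closed_form_of_commuting_frame[OF \<open>open U\<close> net lin(2) smooth(2) vals(3,4) lie]) auto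
  qed (use lin smooth_on_subset[OF smooth(2) B(3)] in auto)
  then obtain f2 where f2: "\<And>q. q \<in> B \<Longrightarrow> (f2 has_derivative \<omega>2 q) (at q)" by blast
  define \<psi> where "\<psi> = (\<lambda>q. (f1 q, f2 q))"
  \<comment> \<open>\<open>\<psi>' q\<close> reads off frame coefficients and
    \<open>\<phi>' q\<close> rebuilds a vector from them; they are mutually inverse on
    \<open>U\<close>.\<close>
  define \<psi>' where "\<psi>' = (\<lambda>q v. (\<omega>1 q v, \<omega>2 q v))"
  define \<phi>' where "\<phi>' = (\<lambda>q v. fst v *\<^sub>R X q + snd v *\<^sub>R Y q)"
  have der\<psi>: "(\<psi> has_derivative \<psi>' q) (at q)" if "q \<in> B" for q
    unfolding \<psi>_def \<psi>'_def by (intro has_derivative_Pair f1 f2 that)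
  have smooth\<psi>': "smooth_on B (\<lambda>q. \<psi>' q v)" for v
    unfolding \<psi>'_def by (intro smooth_on_Pair smooth_on_subset[OF smooth(1) B(3)] smooth_on_subset[OF smooth(2) B(3)] B(1))
  have smooth\<psi>: "smooth_on B \<psi>"
    by (rule smooth_onI[OF B(1) der\<psi> smooth\<psi>'])
  have inv1: "\<psi>' q (\<phi>' q v) = v" if "q \<in> U" for q v
    unfolding \<psi>'_def \<phi>'_def
    by (simp add: linear_add[OF lin(1)] linear_add[OF lin(2)] linear_cmul[OF lin(1)] linear_cmul[OF lin(2)] vals[OF that])
  have inv2: "\<phi>' q (\<psi>' q v) = v" if q: "q \<in> U" for q v
  proof -
    obtain a b where v: "v = a *\<^sub>R X q + b *\<^sub>R Y q" by (rule net_on_expand[OF net q])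
    show ?thesis
      unfolding v \<psi>'_def \<phi>'_def
      by (simp add: linear_add[OF lin(1)] linear_add[OF lin(2)] linear_cmul[OF lin(1)]
          linear_cmul[OF lin(2)] vals[OF q])
  qed
  have "linear (\<psi>' q)" "linear (\<phi>' q)" for q
    unfolding \<psi>'_def \<phi>'_def
    by (rule linearI; simp add: linear_add[OF lin(1)] linear_add[OF lin(2)] linear_cmul[OF lin(1)]
        linear_cmul[OF lin(2)] scaleR_add_left scaleR_add_right)+
  then have bl: "bounded_linear (\<psi>' q)" "bounded_linear (\<phi>' q)" for q
    by (simp_all add: linear_conv_bounded_linear)
  have app: "blinfun_apply (Blinfun (\<psi>' q)) = \<psi>' q" "blinfun_apply (Blinfun (\<phi>' q)) = \<phi>' q" for q
    using bl by (auto simp: bounded_linear_Blinfun_apply)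
  have cont: "continuous_on B (\<lambda>q. Blinfun (\<psi>' q))"
    by (rule continuous_on_blinfun_componentwise) (simp add: app smooth_on_continuous_on[OF smooth\<psi>'])
  have "Blinfun (\<phi>' p) o\<^sub>L Blinfun (\<psi>' p) = id_blinfun"
    by (rule blinfun_eqI) (simp add: app inv2[OF p])
  then obtain V W \<phi> g' where V: "open V" "V \<subseteq> B" "p \<in> V" and W: "open W" and hom: "homeomorphism V W \<psi> \<phi>"
    and der\<phi>: "\<And>y. y \<in> W \<Longrightarrow> (\<phi> has_derivative g' y) (at y)"
    and g': "\<And>y. y \<in> W \<Longrightarrow> g' y = inv (blinfun_apply (Blinfun (\<psi>' (\<phi> y))))"
    using inverse_function_theorem[OF B(1) _ cont B(4)] der\<psi> unfolding app by metis
  have \<phi>V: "\<phi> y \<in> V" if "y \<in> W" for y using hom that by (auto simp: homeomorphism_def)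
  have \<phi>U: "\<phi> y \<in> U" if "y \<in> W" for y using \<phi>V[OF that] V(2) B(3) by blast
  have g'_eq: "g' y = \<phi>' (\<phi> y)" if "y \<in> W" for y
    unfolding g'[OF that] app
    by (rule inv_unique_comp; rule ext; simp add: inv1[OF \<phi>U[OF that]] inv2[OF \<phi>U[OF that]])
  have der\<phi>': "(\<phi> has_derivative \<phi>' (\<phi> y)) (at y)" if "y \<in> W" for y
    using der\<phi>[OF that] g'_eq[OF that] by simp
  \<comment> \<open>Bootstrapping: the derivative of \<open>\<phi>\<close> at \<open>y\<close> is
    the smooth expression \<open>\<phi>'\<close> evaluated at \<open>\<phi> y\<close>, so it is as
    regular as \<open>\<phi>\<close>, and \<open>\<phi>\<close> gains one order.\<close>
  have "Ck_on k W \<phi>" for k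
  proof (induction k)
    case 0
    then show ?case using hom by (simp add: homeomorphism_def)
  next
    case (Suc k)
    show ?case
    proof (rule Ck_on_SucI[OF W der\<phi>'])
      have "smooth_on U (\<lambda>q. \<phi>' q v)" for v
        unfolding \<phi>'_def by (intro smooth_on_add smooth_on_scaleR smooth_on_const X Y \<open>open U\<close>)
      then show "Ck_on k W (\<lambda>y. \<phi>' (\<phi> y) v)" for v
        by (intro Ck_on_compose[OF W \<open>open U\<close> image_subsetI[OF \<phi>U] Suc, of "\<lambda>q. \<phi>' q v"])
          (auto simp: smooth_on_def)
    qed
  qed
  then have "smooth_on W \<phi>" by (simp add: smooth_on_def)
  moreover have "fd \<phi> y (1,0) = X (\<phi> y)" "fd \<phi> y (0,1) = Y (\<phi> y)" if "y \<in> W" for y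
    by (simp_all add: fd_eqI[OF der\<phi>'[OF that]] \<phi>'_def)
  moreover have "V \<subseteq> U" using V(2) B(3) by blast
  ultimately show ?thesis
    by (intro that[OF V(1,3) _ W homeomorphism_symD[OF hom] _ smooth_on_subset[OF smooth\<psi> V(2)]])
qed

section \<open>Surfaces and their Gauss maps\<close>

lemma cross3_unit_normal:
  assumes "norm n = 1" "u \<bullet> n = 0"
  shows "cross3 n (cross3 n u) = - u"
  using assms by (simp add: Lagrange inner_commute norm_eq_1)

lemma cross3_tangent:
  assumes "norm n = 1" "u \<bullet> n = 0" "w \<bullet> n = 0"
  shows "cross3 u w = (cross3 u w \<bullet> n) *\<^sub>R n"
proof -
  have "cross3 n (cross3 u w) = 0" using assms by (simp add: Lagrange inner_commute)
  then have "0 = cross3 n (cross3 n (cross3 u w))" by simp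
  also have "\<dots> = (n \<bullet> cross3 u w) *\<^sub>R n - (n \<bullet> n) *\<^sub>R cross3 u w" by (rule Lagrange)
  finally show ?thesis using assms(1) by (simp add: inner_commute norm_eq_1)
qed

text \<open>A rotation of the tangent plane preserves oriented area.\<close>

lemma cross3_rotated_tangent:
  assumes "norm n = 1" "u \<bullet> n = 0" "w \<bullet> n = 0"
  shows "cross3 (cross3 n u) (cross3 n w) = cross3 u w"
proof -
  have "cross3 (cross3 n u) (cross3 n w) = (cross3 n u \<bullet> w) *\<^sub>R n"
    by (simp add: Lagrange dot_cross_self)
  also have "cross3 n u \<bullet> w = cross3 u w \<bullet> n"
    by (metis cross_triple inner_commute)
  finally show ?thesis using cross3_tangent[OF assms] by simp
qed

text \<open>The triple product of \<open>u\<close>, \<open>u\<close> and \<open>w\<close> is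
  computed twice: by the Lagrange identity, and from the fact that \<open>cross3 u w\<close> is
  normal.\<close>

lemma tangent_orthogonal_eq_cross3:
  assumes "norm n = 1" "u \<bullet> n = 0" "w \<bullet> n = 0" "u \<bullet> w = 0" "u \<noteq> 0"
  shows "w = (w \<bullet> cross3 n u / (u \<bullet> u)) *\<^sub>R cross3 n u"
proof -
  have "- ((u \<bullet> u) *\<^sub>R w) = cross3 u (cross3 u w)" using assms(4) by (simp add: Lagrange)
  also have "\<dots> = cross3 u ((cross3 u w \<bullet> n) *\<^sub>R n)" by (metis cross3_tangent[OF assms(1-3)])
  also have "\<dots> = - ((cross3 u w \<bullet> n) *\<^sub>R cross3 n u)"
    by (metis cross_mult_right cross_skew scaleR_minus_right)
  finally have "(u \<bullet> u) *\<^sub>R w = (cross3 u w \<bullet> n) *\<^sub>R cross3 n u" by simp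
  moreover have "cross3 u w \<bullet> n = w \<bullet> cross3 n u" by (metis cross_triple inner_commute)
  ultimately have "(1 / (u \<bullet> u)) *\<^sub>R ((u \<bullet> u) *\<^sub>R w) = (1 / (u \<bullet> u)) *\<^sub>R ((w \<bullet> cross3 n u) *\<^sub>R cross3 n u)"
    by simp
  then show ?thesis using assms(5) by simp
qed

section \<open>Gauss maps, second fundamental form and curvature\<close>

lemma gauss_map_smooth: "gauss_map U r n \<Longrightarrow> smooth_on U n"
  by (simp add: gauss_map_def)

lemma gauss_map_norm: "gauss_map U r n \<Longrightarrow> p \<in> U \<Longrightarrow> norm (n p) = 1"
  by (simp add: gauss_map_def)

lemma gauss_map_tangent: "gauss_map U r n \<Longrightarrow> p \<in> U \<Longrightarrow> fd r p v \<bullet> n p = 0"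
  unfolding gauss_map_def by blast

lemma unit_fd_orthogonal:
  fixes f :: "'a::real_normed_vector \<Rightarrow> 'b::real_inner"
  assumes "open U" "smooth_on U f" "\<And>q. q \<in> U \<Longrightarrow> norm (f q) = 1" "p \<in> U"
  shows "fd f p v \<bullet> f p = 0"
proof -
  have d: "(f has_derivative fd f p) (at p)" by (rule smooth_on_has_derivative[OF assms(2,4)])
  have "fd (\<lambda>q. f q \<bullet> f q) p = fd (\<lambda>q. 1) p"
    by (rule frechet_derivative_cong_open[OF assms(1,4)]) (use assms(3) in \<open>simp add: norm_eq_1\<close>)
  moreover have "fd (\<lambda>q. f q \<bullet> f q) p = (\<lambda>v. f p \<bullet> fd f p v + fd f p v \<bullet> f p)"
    by (rule fd_eqI[OF has_derivative_inner[OF d d]])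
  ultimately have "f p \<bullet> fd f p v + fd f p v \<bullet> f p = 0" by (metis frechet_derivative_const)
  then show ?thesis by (simp add: inner_commute)
qed

lemma gauss_map_fd_orthogonal:
  "open U \<Longrightarrow> gauss_map U r n \<Longrightarrow> p \<in> U \<Longrightarrow> fd n p v \<bullet> n p = 0"
  using unit_fd_orthogonal[of U n p v] by (simp add: gauss_map_def)

text \<open>Differentiating the orthogonality of \<open>fd r p v\<close> and the normal shows each
  side to be minus the normal component of a second derivative of \<open>r\<close>, which is
  symmetric.\<close>

lemma second_form_symmetric:
  assumes "open U" "smooth_on U r" "gauss_map U r n" "p \<in> U"
  shows "fd r p v \<bullet> fd n p w = fd r p w \<bullet> fd n p v"
proof -
  have "fd (\<lambda>q. fd r q v) p w \<bullet> n p = - (fd r p v \<bullet> fd n p w)" for v w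
  proof -
    note d = smooth_on_has_derivative[OF smooth_on_fd_const[OF assms(2), of v] assms(4)]
      smooth_on_has_derivative[OF gauss_map_smooth[OF assms(3)] assms(4)]
    have "fd (\<lambda>q. fd r q v \<bullet> n q) p = fd (\<lambda>q. 0) p"
      by (rule frechet_derivative_cong_open[OF assms(1,4)]) (rule gauss_map_tangent[OF assms(3)])
    moreover have "fd (\<lambda>q. fd r q v \<bullet> n q) p = (\<lambda>w. fd r p v \<bullet> fd n p w + fd (\<lambda>q. fd r q v) p w \<bullet> n p)"
      by (rule fd_eqI[OF has_derivative_inner[OF d]])
    ultimately have "fd r p v \<bullet> fd n p w + fd (\<lambda>q. fd r q v) p w \<bullet> n p = 0" by (metis frechet_derivative_const)
    then show ?thesis by simp
  qed
  then show ?thesis using second_derivative_symmetric[OF assms(1,2,4), of v w] by (metis neg_equal_iff_equal)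
qed

lemma cross3_independent_nonzero:
  fixes L :: "real \<times> real \<Rightarrow> real ^ 3"
  assumes "linear L" "inj L" and indep: "\<And>a b. a *\<^sub>R v + b *\<^sub>R w = 0 \<Longrightarrow> a = 0 \<and> b = 0"
  shows "cross3 (L v) (L w) \<noteq> 0"
proof
  assume "cross3 (L v) (L w) = 0"
  then have "L v = 0 \<or> L w = 0 \<or> (\<exists>c. L w = c *\<^sub>R L v)"
    by (simp add: cross_eq_0 collinear_lemma)
  then have "\<exists>a b. L (a *\<^sub>R v + b *\<^sub>R w) = 0 \<and> (a \<noteq> 0 \<or> b \<noteq> 0)"
  proof (elim disjE exE)
    assume "L v = 0" then show ?thesis by (intro exI[of _ 1] exI[of _ 0]) simp
  next
    assume "L w = 0" then show ?thesis by (intro exI[of _ 0] exI[of _ 1]) simp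
  next
    fix c assume "L w = c *\<^sub>R L v"
    then show ?thesis
      by (intro exI[of _ c] exI[of _ "-1"]) (simp add: linear_diff[OF assms(1)] linear_add[OF assms(1)] linear_cmul[OF assms(1)] linear_neg[OF assms(1)])
  qed
  then show False using assms(2) indep linear_injective_0[OF assms(1)] by blast
qed

text \<open>The Gauss curvature is the factor by which the Gauss map scales oriented area. For the
  coordinate vectors, the Binet-Cauchy identity \<open>dot_cross\<close> turns its numerator and
  denominator into \<open>R \<bullet> N\<close> and \<open>R \<bullet> R\<close>, where
  \<open>R\<close> and \<open>N\<close> are both normal.\<close>

lemma weingarten_cross3:
  assumes r: "regular_surface U r" and n: "gauss_map U r n" and p: "p \<in> U"
  shows "cross3 (fd n p v) (fd n p w) = gauss_curvature r n p *\<^sub>R cross3 (fd r p v) (fd r p w)"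
proof -
  have U: "open U" "smooth_on U r" "inj (fd r p)" using r p by (auto simp: regular_surface_def)
  note linr = smooth_on_linear_fd[OF U(2) p]
  note linn = smooth_on_linear_fd[OF gauss_map_smooth[OF n] p]
  note nn = gauss_map_norm[OF n p]
  define R where "R = cross3 (fd r p (1,0)) (fd r p (0,1))"
  define N where "N = cross3 (fd n p (1,0)) (fd n p (0,1))"
  have R: "R = (R \<bullet> n p) *\<^sub>R n p"
    unfolding R_def by (rule cross3_tangent[OF nn gauss_map_tangent[OF n p] gauss_map_tangent[OF n p]])
  have N: "N = (N \<bullet> n p) *\<^sub>R n p"
    unfolding N_def
    by (rule cross3_tangent[OF nn gauss_map_fd_orthogonal[OF U(1) n p] gauss_map_fd_orthogonal[OF U(1) n p]])
  have "R \<noteq> 0" unfolding R_def by (rule cross3_independent_nonzero[OF linr U(3)]) (simp add: prod_eq_iff)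
  have "R \<bullet> N = second_form r n p (1,0) (1,0) * second_form r n p (0,1) (0,1) - (second_form r n p (1,0) (0,1))\<^sup>2"
    using second_form_symmetric[OF U(1,2) n p, of "(1,0)" "(0,1)"]
    by (simp add: R_def N_def dot_cross second_form_def power2_eq_square)
  moreover have "R \<bullet> R = first_form r p (1,0) (1,0) * first_form r p (0,1) (0,1) - (first_form r p (1,0) (0,1))\<^sup>2"
    by (simp add: R_def dot_cross first_form_def power2_eq_square inner_commute)
  ultimately have K: "gauss_curvature r n p = (R \<bullet> N) / (R \<bullet> R)" by (simp add: gauss_curvature_def)
  have "R \<bullet> N = (R \<bullet> n p) * (N \<bullet> n p)" by (metis N inner_commute inner_scaleR_right mult.commute)
  moreover have "R \<bullet> R = (R \<bullet> n p) * (R \<bullet> n p)" by (metis R inner_scaleR_right)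
  moreover have "R \<bullet> n p \<noteq> 0" using R \<open>R \<noteq> 0\<close> by force
  ultimately have "N \<bullet> n p = gauss_curvature r n p * (R \<bullet> n p)" by (simp add: K)
  then have NR: "N = gauss_curvature r n p *\<^sub>R R" by (metis N R scaleR_scaleR)
  \<comment> \<open>Passing to arbitrary \<open>v\<close> and \<open>w\<close> multiplies both cross
    products by the same determinant.\<close>
  have exp: "cross3 (L v) (L w) = (fst v * snd w - snd v * fst w) *\<^sub>R cross3 (L (1,0)) (L (0,1))"
    if L: "linear L" for L :: "real \<times> real \<Rightarrow> real ^ 3"
  proof -
    have "x = fst x *\<^sub>R (1,0) + snd x *\<^sub>R (0,1)" for x :: "real \<times> real" by (simp add: prod_eq_iff)
    then have "L x = fst x *\<^sub>R L (1,0) + snd x *\<^sub>R L (0,1)" for x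
      by (metis linear_add[OF L] linear_cmul[OF L])
    then have "cross3 (L v) (L w) = cross3 (fst v *\<^sub>R L (1,0) + snd v *\<^sub>R L (0,1)) (fst w *\<^sub>R L (1,0) + snd w *\<^sub>R L (0,1))"
      by metis
    also have "\<dots> = (fst v * snd w - snd v * fst w) *\<^sub>R cross3 (L (1,0)) (L (0,1))"
      using cross_skew[of "L (0,1)" "L (1,0)"]
      by (simp add: cross_add_left cross_add_right cross_mult_left cross_mult_right scaleR_diff_left mult.commute)
    finally show ?thesis .
  qed
  show ?thesis
    unfolding exp[OF linn] exp[OF linr] using NR by (simp add: N_def R_def mult.commute)
qed

text \<open>The quotient of \<open>f\<close> and its absolute value is continuous with finite range,
  hence constant.\<close>

lemma constant_sign_on_connected:
  fixes f :: "'a::metric_space \<Rightarrow> real"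
  assumes "connected V" "continuous_on V f" "\<And>p. p \<in> V \<Longrightarrow> f p \<noteq> 0"
  shows "\<exists>\<epsilon>\<in>{1, -1}. \<forall>p\<in>V. f p = \<epsilon> * \<bar>f p\<bar>"
proof -
  have "continuous_on V (\<lambda>p. f p / \<bar>f p\<bar>)" using assms by (intro continuous_intros) auto
  moreover have fin: "(\<lambda>p. f p / \<bar>f p\<bar>) ` V \<subseteq> {1, -1}" 
    using assms(3) by (intro image_subsetI) (simp add: abs_if)
  ultimately have "(\<lambda>p. f p / \<bar>f p\<bar>) constant_on V"
    by (intro continuous_finite_range_constant[OF assms(1)]) (auto intro: finite_subset)
  then obtain c where c: "\<And>p. p \<in> V \<Longrightarrow> f p / \<bar>f p\<bar> = c" by (auto simp: constant_on_def)
  show ?thesis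
  proof (cases "V = {}")
    case False
    then have "c \<in> {1, -1}" using fin c by blast
    moreover have "f p = c * \<bar>f p\<bar>" if "p \<in> V" for p using c[OF that] assms(3)[OF that] by (simp add: field_simps)
    ultimately show ?thesis by blast
  qed auto
qed

section \<open>Asymptotic nets\<close>

lemma regular_surfaceD:
  assumes "regular_surface U r"
  shows "open U" "smooth_on U r" "\<And>p. p \<in> U \<Longrightarrow> inj (fd r p)" "\<And>p. p \<in> U \<Longrightarrow> linear (fd r p)"
  using assms smooth_on_linear_fd unfolding regular_surface_def by blast+

lemma regular_surface_subset: "regular_surface U r \<Longrightarrow> open V \<Longrightarrow> V \<subseteq> U \<Longrightarrow> regular_surface V r"
  unfolding regular_surface_def using smooth_on_subset by blast

lemma gauss_map_subset: "gauss_map U r n \<Longrightarrow> V \<subseteq> U \<Longrightarrow> gauss_map V r n"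
  unfolding gauss_map_def using smooth_on_subset by blast

lemma net_onD:
  assumes "net_on U X Y"
  shows "smooth_on U X" "smooth_on U Y"
    "\<And>p a b. p \<in> U \<Longrightarrow> a *\<^sub>R X p + b *\<^sub>R Y p = 0 \<Longrightarrow> a = 0 \<and> b = 0"
  using assms unfolding net_on_def by blast+

lemma net_on_nonzero:
  assumes "net_on U X Y" "p \<in> U"
  shows "X p \<noteq> 0" "Y p \<noteq> 0"
  using net_onD(3)[OF assms, of 1 0] net_onD(3)[OF assms, of 0 1] by auto

lemma net_on_subset: "net_on U X Y \<Longrightarrow> V \<subseteq> U \<Longrightarrow> net_on V X Y"
  unfolding net_on_def using smooth_on_subset by blast

lemma asymptotic_net_subset: "asymptotic_net U r n X Y \<Longrightarrow> V \<subseteq> U \<Longrightarrow> asymptotic_net V r n X Y"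
  unfolding asymptotic_net_def using net_on_subset by blast

lemma regular_surface_fd_nonzero:
  assumes "regular_surface U r" "p \<in> U" "v \<noteq> 0"
  shows "fd r p v \<noteq> 0"
  using regular_surfaceD[OF assms(1)] assms(2,3) linear_injective_0 by blast

text \<open>This is the Beltrami--Enneper theorem; up to sign, \<open>s\<close> is the torsion of the asymptotic line.\<close>

lemma asymptotic_directions_rotate:
  assumes r: "regular_surface U r" and n: "gauss_map U r n" and net: "asymptotic_net U r n X Y" and p: "p \<in> U"
    and K: "gauss_curvature r n p = - \<kappa>\<^sup>2"
    and s: "s = fd n p (X p) \<bullet> cross3 (n p) (fd r p (X p)) / (fd r p (X p) \<bullet> fd r p (X p))"
  shows "s\<^sup>2 = \<kappa>\<^sup>2" "fd n p (X p) = s *\<^sub>R cross3 (n p) (fd r p (X p))"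
    "fd n p (Y p) = - s *\<^sub>R cross3 (n p) (fd r p (Y p))"
proof -
  note U = regular_surfaceD(1,2)[OF r]
  have net': "net_on U X Y" using net by (simp add: asymptotic_net_def)
  define x where "x = fd r p (X p)"
  define y where "y = fd r p (Y p)"
  have nn: "norm (n p) = 1" by (rule gauss_map_norm[OF n p])
  have xn: "x \<bullet> n p = 0" and yn: "y \<bullet> n p = 0" unfolding x_def y_def by (rule gauss_map_tangent[OF n p])+
  note perp = gauss_map_fd_orthogonal[OF U(1) n p]
  have x0: "x \<noteq> 0" and y0: "y \<noteq> 0"
    unfolding x_def y_def by (rule regular_surface_fd_nonzero[OF r p net_on_nonzero(1)[OF net' p]]
        regular_surface_fd_nonzero[OF r p net_on_nonzero(2)[OF net' p]])+
  have "x \<bullet> fd n p (X p) = 0" "y \<bullet> fd n p (Y p) = 0"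
    using net p by (auto simp: asymptotic_net_def asymptotic_direction_def second_form_def x_def y_def)
  \<comment> \<open>On an asymptotic direction the derivatives of \<open>r\<close> and
    \<open>n\<close> are orthogonal tangent vectors, so the latter is a multiple of the quarter turn
    of the former.\<close>
  note * = tangent_orthogonal_eq_cross3[OF nn xn perp this(1) x0] tangent_orthogonal_eq_cross3[OF nn yn perp this(2) y0]
  show 1: "fd n p (X p) = s *\<^sub>R cross3 (n p) (fd r p (X p))"
    using *(1) by (simp add: s x_def)
  define t where "t = fd n p (Y p) \<bullet> cross3 (n p) y / (y \<bullet> y)"
  have 2: "fd n p (Y p) = t *\<^sub>R cross3 (n p) y" using *(2) by (simp add: t_def)
  define \<rho> where "\<rho> = cross3 x y \<bullet> n p"
  have xy: "cross3 x y = \<rho> *\<^sub>R n p" unfolding \<rho>_def by (rule cross3_tangent[OF nn xn yn])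
  have "cross3 x y \<noteq> 0"
    unfolding x_def y_def
    by (rule cross3_independent_nonzero[OF regular_surfaceD(4)[OF r p] regular_surfaceD(3)[OF r p] net_onD(3)[OF net' p]])
  then have \<rho>: "\<rho> \<noteq> 0" using xy by auto
  \<comment> \<open>Symmetry of the second fundamental form forces the two factors to be
    opposite.\<close>
  have "x \<bullet> fd n p (Y p) = y \<bullet> fd n p (X p)"
    unfolding x_def y_def by (rule second_form_symmetric[OF U n p])
  moreover have "x \<bullet> cross3 (n p) y = - \<rho>" "y \<bullet> cross3 (n p) x = \<rho>"
    unfolding \<rho>_def by (metis cross_skew cross_triple inner_commute inner_minus_right inner_minus_left)+
  ultimately have "- (t * \<rho>) = s * \<rho>" using 1 2 by (simp add: x_def)
  then have t: "t = - s" using \<rho> by (metis minus_mult_left mult_cancel_right minus_minus)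
  with 2 show "fd n p (Y p) = - s *\<^sub>R cross3 (n p) (fd r p (Y p))" by (simp add: y_def)
  \<comment> \<open>Quarter turns preserve the cross product, so the curvature is the product of the
    two factors.\<close>
  have "- \<kappa>\<^sup>2 *\<^sub>R cross3 x y = cross3 (fd n p (X p)) (fd n p (Y p))"
    using weingarten_cross3[OF r n p, of "X p" "Y p"] by (simp add: K x_def y_def)
  also have "\<dots> = - s\<^sup>2 *\<^sub>R cross3 (cross3 (n p) x) (cross3 (n p) y)"
    unfolding 1 2 t by (simp add: x_def cross_mult_left cross_mult_right power2_eq_square)
  also have "\<dots> = - s\<^sup>2 *\<^sub>R cross3 x y" by (simp only: cross3_rotated_tangent[OF nn xn yn])
  finally show "s\<^sup>2 = \<kappa>\<^sup>2" using \<open>cross3 x y \<noteq> 0\<close> by simp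
qed

text \<open>The factor of the first family is continuous with square
  \<open>\<kappa>\<^sup>2\<close>, so on a connected set it cannot switch between its two possible
  values.\<close>

lemma asymptotic_net_rotates:
  assumes r: "regular_surface V r" and n: "gauss_map V r n" and net: "asymptotic_net V r n X Y"
    and "connected V" "\<kappa> \<noteq> 0" and K: "\<And>p. p \<in> V \<Longrightarrow> gauss_curvature r n p = - \<kappa>\<^sup>2"
  shows "\<exists>s\<in>{\<kappa>, - \<kappa>}. \<forall>p\<in>V. fd n p (X p) = s *\<^sub>R cross3 (n p) (fd r p (X p)) \<and>
    fd n p (Y p) = - s *\<^sub>R cross3 (n p) (fd r p (Y p))"
proof -
  note V = regular_surfaceD(1,2)[OF r]
  have net': "net_on V X Y" using net by (simp add: asymptotic_net_def)
  define s where "s = (\<lambda>p. fd n p (X p) \<bullet> cross3 (n p) (fd r p (X p)) / (fd r p (X p) \<bullet> fd r p (X p)))"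
  have rot: "(s p)\<^sup>2 = \<kappa>\<^sup>2" "fd n p (X p) = s p *\<^sub>R cross3 (n p) (fd r p (X p))"
    "fd n p (Y p) = - s p *\<^sub>R cross3 (n p) (fd r p (Y p))" if "p \<in> V" for p
    using asymptotic_directions_rotate[OF r n net that K[OF that], of "s p"] by (auto simp: s_def)
  have "smooth_on V s"
    unfolding s_def
    by (intro smooth_on_divide smooth_on_inner smooth_on_cross3 smooth_on_fd V net_onD(1)[OF net'] gauss_map_smooth[OF n])
      (use regular_surface_fd_nonzero[OF r _ net_on_nonzero(1)[OF net']] in simp)
  then have "continuous_on V s" by (rule smooth_on_continuous_on)
  moreover have "s p \<noteq> 0" if "p \<in> V" for p using rot(1)[OF that] \<open>\<kappa> \<noteq> 0\<close> by auto
  ultimately obtain e where e: "e \<in> {1, -1}" "\<And>p. p \<in> V \<Longrightarrow> s p = e * \<bar>s p\<bar>"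
    using constant_sign_on_connected[OF \<open>connected V\<close>] by metis
  have "\<bar>s p\<bar> = \<bar>\<kappa>\<bar>" if "p \<in> V" for p using rot(1)[OF that] by (simp add: power2_eq_iff abs_eq_iff)
  then have "s p = e * \<bar>\<kappa>\<bar>" if "p \<in> V" for p using e(2) that by metis
  moreover have "e * \<bar>\<kappa>\<bar> \<in> {\<kappa>, - \<kappa>}" using e(1) by auto
  ultimately show ?thesis using rot(2,3) by metis
qed

text \<open>Negative curvature makes the discriminant of the second fundamental form positive, so
  there are two distinct null directions. The task is to represent them by smooth fields that are
  independent throughout a neighbourhood.\<close>

lemma local_asymptotic_net:
  assumes r: "regular_surface U r" and n: "gauss_map U r n" and p: "p \<in> U"
    and K: "\<And>q. q \<in> U \<Longrightarrow> gauss_curvature r n q < 0"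
  obtains V X Y where "open V" "p \<in> V" "V \<subseteq> U" "asymptotic_net V r n X Y"
proof -
  note result = that
  note U = regular_surfaceD(1,2)[OF r]
  define L where "L = (\<lambda>q. second_form r n q (1,0) (1,0))"
  define M where "M = (\<lambda>q. second_form r n q (1,0) (0,1))"
  define N where "N = (\<lambda>q. second_form r n q (0,1) (0,1))"
  have smooth: "smooth_on U L" "smooth_on U M" "smooth_on U N"
    unfolding L_def M_def N_def second_form_def
    by (intro smooth_on_minus smooth_on_inner smooth_on_fd_const U gauss_map_smooth[OF n])+
  have II: "second_form r n q (a, b) (a, b) = L q * a\<^sup>2 + 2 * M q * a * b + N q * b\<^sup>2" if "q \<in> U" for q a b
  proof -
    have "A (a, b) = a *\<^sub>R A (1,0) + b *\<^sub>R A (0,1)" if "linear A" for A :: "real \<times> real \<Rightarrow> real ^ 3"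
    proof -
      have "A (a, b) = A (a *\<^sub>R (1,0) + b *\<^sub>R (0,1))" by simp
      also have "\<dots> = a *\<^sub>R A (1,0) + b *\<^sub>R A (0,1)" by (simp only: linear_add[OF that] linear_cmul[OF that])
      finally show ?thesis .
    qed
    from this[OF smooth_on_linear_fd[OF U(2) that]] this[OF smooth_on_linear_fd[OF gauss_map_smooth[OF n] that]]
    have "fd r q (a, b) = a *\<^sub>R fd r q (1,0) + b *\<^sub>R fd r q (0,1)" "fd n q (a, b) = a *\<^sub>R fd n q (1,0) + b *\<^sub>R fd n q (0,1)" .
    then show ?thesis
      using second_form_symmetric[OF U n that, of "(1,0)" "(0,1)"]
      by (simp add: second_form_def L_def M_def N_def inner_add_left inner_add_right algebra_simps power2_eq_square)
  qed
  have pos: "(M q)\<^sup>2 - L q * N q > 0" if "q \<in> U" for q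
  proof -
    define R where "R = cross3 (fd r q (1,0)) (fd r q (0,1))"
    have "R \<noteq> 0" unfolding R_def
      by (rule cross3_independent_nonzero[OF regular_surfaceD(4)[OF r that] regular_surfaceD(3)[OF r that]])
        (simp add: prod_eq_iff)
    have "R \<bullet> R = first_form r q (1,0) (1,0) * first_form r q (0,1) (0,1) - (first_form r q (1,0) (0,1))\<^sup>2"
      by (simp add: R_def dot_cross first_form_def power2_eq_square inner_commute)
    then have "gauss_curvature r n q = (L q * N q - (M q)\<^sup>2) / (R \<bullet> R)"
      by (simp add: gauss_curvature_def L_def M_def N_def)
    then show ?thesis using K[OF that] inner_ge_zero[of R] by (simp add: divide_less_0_iff not_less)
  qed
  define D where "D = (\<lambda>q. sqrt ((M q)\<^sup>2 - L q * N q))"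
  have D: "D q > 0" "D q * D q = M q * M q - L q * N q" if "q \<in> U" for q
    using pos[OF that] by (auto simp: D_def power2_eq_square)
  have smoothD: "smooth_on U D"
    unfolding D_def power2_eq_square
    by (intro smooth_on_sqrt smooth_on_diff smooth_on_mult smooth U(1)) (use pos in \<open>simp add: power2_eq_square\<close>)
  \<comment> \<open>The roots of the quadratic form, in a shape that stays nonzero where \<open>L\<close> or \<open>N\<close> vanishes.\<close>
  have main: thesis if c: "c \<in> {1, -1}" and cp: "c * M p + D p > 0" for c
  proof -
    define P where "P = (\<lambda>q. c * M q + D q)"
    \<comment> \<open>The part of \<open>U\<close> where the sign \<open>c\<close>, chosen at
      \<open>p\<close>, still makes \<open>P\<close> positive.\<close>
    define V where "V = U \<inter> P -` {0<..}"
    define X where "X = (\<lambda>q. (N q, - (c * P q)))"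
    define Y where "Y = (\<lambda>q. (- (c * P q), L q))"
    have smoothP: "smooth_on U P" unfolding P_def by (intro smooth_on_add smooth_on_mult smooth_on_const smooth smoothD U(1))
    have V: "open V" "p \<in> V" "V \<subseteq> U"
      using continuous_on_open_vimage[OF U(1), of P] smooth_on_continuous_on[OF smoothP] p cp
      by (auto simp: V_def P_def Int_commute)
    \<comment> \<open>The equation says that \<open>P\<close> is a root of the quadratic with
      coefficients \<open>1\<close>, \<open>- 2 * c * M\<close> and \<open>L * N\<close>, which
      makes \<open>X\<close> and \<open>Y\<close> null. The last inequality says that the
      determinant of \<open>X\<close> and \<open>Y\<close> is negative.\<close>
    have P: "P q > 0" "P q * P q = 2 * (c * M q * P q) - L q * N q" "P q * P q - L q * N q > 0"
      if "q \<in> V" for q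
    proof -
      have q: "q \<in> U" and "P q > 0" using that by (auto simp: V_def)
      have cc: "c * c = 1" using c by auto
      have "P q * P q = (c * c) * (M q * M q) + 2 * (c * M q * D q) + D q * D q"
        by (simp add: P_def algebra_simps)
      then have 1: "P q * P q = 2 * (M q * M q) + 2 * (c * M q * D q) - L q * N q" using cc D(2)[OF q] by simp
      have 2: "c * M q * P q = (c * c) * (M q * M q) + c * M q * D q" by (simp add: P_def algebra_simps)
      show "P q * P q = 2 * (c * M q * P q) - L q * N q" using 1 2 cc by simp
      have "P q * D q = c * M q * D q + D q * D q" by (simp add: P_def algebra_simps)
      with 1 D(2)[OF q] have "P q * P q - L q * N q = 2 * (P q * D q)" by simp
      with \<open>P q > 0\<close> D(1)[OF q] show "P q * P q - L q * N q > 0" by simp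
      show "P q > 0" by fact
    qed
    have net: "net_on V X Y"
      unfolding net_on_def
    proof (intro conjI ballI allI impI)
      have VU: "smooth_on V f" if "smooth_on U f" for f :: "real \<times> real \<Rightarrow> real"
        by (rule smooth_on_subset[OF that V(3)])
      show "smooth_on V X" "smooth_on V Y" unfolding X_def Y_def
        by (intro smooth_on_Pair smooth_on_minus smooth_on_mult smooth_on_const VU smooth smoothP V(1))+
      fix q a b assume q: "q \<in> V" and ab: "a *\<^sub>R X q + b *\<^sub>R Y q = 0"
      have 1: "a * N q = b * (c * P q)" and 2: "b * L q = a * (c * P q)"
        using ab by (auto simp: X_def Y_def zero_prod_def)
      have cc: "c * c = 1" using c by auto
      have "a * (L q * N q) = L q * (a * N q)" by (simp only: ac_simps)
      also have "\<dots> = (b * L q) * (c * P q)" unfolding 1 by (simp only: ac_simps)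
      also have "\<dots> = (c * c) * (a * (P q * P q))" unfolding 2 by (simp only: ac_simps)
      finally have "a * (L q * N q) = (c * c) * (a * (P q * P q))" .
      then have "a * (P q * P q - L q * N q) = 0" by (auto simp: cc algebra_simps)
      moreover have "b * (P q * P q - L q * N q) = 0"
      proof -
        have "b * (L q * N q) = N q * (b * L q)" by (simp only: ac_simps)
        also have "\<dots> = (a * N q) * (c * P q)" unfolding 2 by (simp only: ac_simps)
        also have "\<dots> = (c * c) * (b * (P q * P q))" unfolding 1 by (simp only: ac_simps)
        finally show ?thesis by (auto simp: cc algebra_simps)
      qed
      ultimately show "a = 0" "b = 0" using P(3)[OF q] by auto
    qed
    have "second_form r n q (X q) (X q) = 0" "second_form r n q (Y q) (Y q) = 0" if "q \<in> V" for q
    proof -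
      have q: "q \<in> U" using that V(3) by blast
      have cc: "c * c = 1" using c by auto
      have "second_form r n q (X q) (X q) = N q * (L q * N q - 2 * (c * M q * P q) + (c * c) * (P q * P q))"
        unfolding X_def II[OF q] by (simp add: algebra_simps power2_eq_square)
      then show "second_form r n q (X q) (X q) = 0" unfolding cc using P(2)[OF that] by simp
      have "second_form r n q (Y q) (Y q) = L q * (L q * N q - 2 * (c * M q * P q) + (c * c) * (P q * P q))"
        unfolding Y_def II[OF q] by (simp add: algebra_simps power2_eq_square)
      then show "second_form r n q (Y q) (Y q) = 0" unfolding cc using P(2)[OF that] by simp
    qed
    then have "asymptotic_net V r n X Y"
      using net net_on_nonzero[OF net] by (simp add: asymptotic_net_def asymptotic_direction_def)
    with V show thesis by (rule result)
  qed
  \<comment> \<open>The two expressions have the positive sum \<open>2 * D p\<close>.\<close>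
  have "1 * M p + D p > 0 \<or> -1 * M p + D p > 0" using D(1)[OF p] by linarith
  then show thesis using main[of 1] main[of "-1"] by blast
qed

section \<open>The middle surface\<close>

lemma fd_middle_surface:
  assumes "smooth_on U r" "smooth_on U r'" "p \<in> U"
  shows "fd (middle_surface r r') p v = (1/2) *\<^sub>R (fd r p v + fd r' p v)"
proof -
  have "middle_surface r r' = (\<lambda>p. (1/2) *\<^sub>R r p + (1/2) *\<^sub>R r' p)" by (auto simp: middle_surface_def)
  moreover have "((\<lambda>p. (1/2) *\<^sub>R r p + (1/2) *\<^sub>R r' p) has_derivative
      (\<lambda>v. (1/2) *\<^sub>R fd r p v + (1/2) *\<^sub>R fd r' p v)) (at p)"
    by (intro has_derivative_add has_derivative_scaleR_right
        smooth_on_has_derivative[OF assms(1,3)] smooth_on_has_derivative[OF assms(2,3)])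
  ultimately show ?thesis by (simp add: fd_eqI scaleR_add_right)
qed

lemma gauss_map_middle_surface:
  assumes "gauss_map U r n" "gauss_map U r' n" "smooth_on U r" "smooth_on U r'"
  shows "gauss_map U (middle_surface r r') n"
  unfolding gauss_map_def
proof (intro conjI ballI allI)
  fix p v assume p: "p \<in> U"
  show "fd (middle_surface r r') p v \<bullet> n p = 0"
    unfolding fd_middle_surface[OF assms(3,4) p]
    by (simp add: inner_add_left gauss_map_tangent[OF assms(1) p] gauss_map_tangent[OF assms(2) p])
qed (use assms(1) in \<open>auto simp: gauss_map_def\<close>)

lemma fd_vf_deriv_rotated:
  fixes Z :: "'a::euclidean_space \<Rightarrow> 'a" and f n :: "'a \<Rightarrow> real ^ 3"
  assumes "open U" "smooth_on U n" "smooth_on U Z" "p \<in> U"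
    and rot: "\<And>q. q \<in> U \<Longrightarrow> fd f q (Z q) = c *\<^sub>R cross3 (n q) (fd n q (Z q))"
  shows "fd (vf_deriv Z f) p w =
    c *\<^sub>R (cross3 (n p) (fd (vf_deriv Z n) p w) + cross3 (fd n p w) (fd n p (Z p)))"
proof -
  have Zn: "smooth_on U (vf_deriv Z n)"
    unfolding vf_deriv_def by (rule smooth_on_fd[OF assms(1-3)])
  have "fd (vf_deriv Z f) p = fd (\<lambda>q. c *\<^sub>R cross3 (n q) (vf_deriv Z n q)) p"
    by (rule frechet_derivative_cong_open[OF assms(1,4)]) (simp add: vf_deriv_def rot)
  also have "\<dots> = (\<lambda>w. c *\<^sub>R (cross3 (n p) (fd (vf_deriv Z n) p w) + cross3 (fd n p w) (vf_deriv Z n p)))"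
    by (intro fd_eqI has_derivative_scaleR_right
        bounded_bilinear.FDERIV[OF bilinear_cross[unfolded bilinear_conv_bounded_bilinear]]
        smooth_on_has_derivative[OF Zn assms(4)] smooth_on_has_derivative[OF assms(2,4)])
  finally show ?thesis by (simp add: vf_deriv_def)
qed

text \<open>One family from each surface, with opposite rotation factors. The rotation equations are
  homogeneous in \<open>X\<close> and \<open>Y\<close>, so the locale can be interpreted again for
  rescaled fields.\<close>

locale opposite_rotations =
  fixes V :: "(real \<times> real) set" and r r' n :: "real \<times> real \<Rightarrow> real ^ 3"
    and X Y :: "real \<times> real \<Rightarrow> real \<times> real" and m :: real
  assumes surfaces: "regular_surface V r" "regular_surface V r'" "regular_surface V (middle_surface r r')"
    and gauss: "gauss_map V r n" "gauss_map V r' n"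
    and net: "net_on V X Y"
    and rotX: "\<And>p. p \<in> V \<Longrightarrow> fd r p (X p) = m *\<^sub>R cross3 (n p) (fd n p (X p))"
    and rotY: "\<And>p. p \<in> V \<Longrightarrow> fd r' p (Y p) = - m *\<^sub>R cross3 (n p) (fd n p (Y p))"
begin

abbreviation "rm \<equiv> middle_surface r r'"

lemmas openV = regular_surfaceD(1)[OF surfaces(1)]
lemmas smooth = regular_surfaceD(2)[OF surfaces(1)] regular_surfaceD(2)[OF surfaces(2)]
  regular_surfaceD(2)[OF surfaces(3)] gauss_map_smooth[OF gauss(1)]
lemmas smoothXY = net_onD(1,2)[OF net]
lemmas gauss_rm = gauss_map_middle_surface[OF gauss smooth(1,2)]
lemmas fd_rm = fd_middle_surface[OF smooth(1,2)]

lemma vf_deriv_vf_deriv_rm: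
  assumes "smooth_on V Z" "p \<in> V"
  shows "vf_deriv W (vf_deriv Z rm) p = (1/2) *\<^sub>R (vf_deriv W (vf_deriv Z r) p + vf_deriv W (vf_deriv Z r') p)"
proof -
  have Z: "smooth_on V (vf_deriv Z r)" "smooth_on V (vf_deriv Z r')"
    unfolding vf_deriv_def by (intro smooth_on_fd openV smooth assms(1))+
  have "fd (vf_deriv Z rm) p = fd (\<lambda>q. (1/2) *\<^sub>R (vf_deriv Z r q + vf_deriv Z r' q)) p"
    by (rule frechet_derivative_cong_open[OF openV assms(2)]) (simp add: vf_deriv_def fd_rm)
  also have "\<dots> = (\<lambda>w. (1/2) *\<^sub>R (fd (vf_deriv Z r) p w + fd (vf_deriv Z r') p w))"
    by (intro fd_eqI has_derivative_scaleR_right has_derivative_add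
        smooth_on_has_derivative[OF Z(1) assms(2)] smooth_on_has_derivative[OF Z(2) assms(2)])
  finally show ?thesis by (simp add: vf_deriv_def[of W])
qed

text \<open>Because the two rotations are opposite, the tangential terms \<open>n \<times> n\<^sub>X\<^sub>Y\<close> of the mixed second
  derivatives of \<open>r\<close> and \<open>r'\<close> cancel up to the contribution of the Lie bracket.\<close>

lemma mixed_derivatives_rm:
  assumes p: "p \<in> V" and lie: "lie_bracket X Y p = \<alpha> *\<^sub>R X p + \<beta> *\<^sub>R Y p"
  shows "vf_deriv Y (vf_deriv X rm) p =
      - m *\<^sub>R cross3 (fd n p (X p)) (fd n p (Y p)) - \<alpha> *\<^sub>R fd rm p (X p)"
    and "vf_deriv X (vf_deriv Y rm) p =
      - m *\<^sub>R cross3 (fd n p (X p)) (fd n p (Y p)) + \<beta> *\<^sub>R fd rm p (Y p)"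
proof -
  define N where "N = cross3 (fd n p (X p)) (fd n p (Y p))"
  define Z where "Z = lie_bracket X Y p"
  define YXn where "YXn = vf_deriv Y (vf_deriv X n) p"
  have swap: "cross3 (fd n p (Y p)) (fd n p (X p)) = - N" unfolding N_def by (rule cross_skew)
  note bracket = vf_deriv_lie_bracket[OF openV _ smoothXY p]
  have 1: "vf_deriv Y (vf_deriv X r) p = m *\<^sub>R (cross3 (n p) YXn - N)"
    unfolding vf_deriv_def[of Y] YXn_def
    by (subst fd_vf_deriv_rotated[OF openV smooth(4) smoothXY(1) p rotX]) (simp_all add: swap)
  have 2: "vf_deriv X (vf_deriv Y r') p = - m *\<^sub>R (cross3 (n p) (YXn + fd n p Z) + N)"
    unfolding YXn_def Z_def bracket[OF smooth(4), symmetric] N_def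
    unfolding vf_deriv_def[of X] by (rule fd_vf_deriv_rotated[OF openV smooth(4) smoothXY(2) p rotY])
  have 3: "vf_deriv X (vf_deriv Y r') p = vf_deriv Y (vf_deriv X r') p + fd r' p Z"
    unfolding Z_def by (rule bracket[OF smooth(2)])
  have lin: "fd f p Z = \<alpha> *\<^sub>R fd f p (X p) + \<beta> *\<^sub>R fd f p (Y p)" if "smooth_on V f" for f :: "real \<times> real \<Rightarrow> real ^ 3"
    using linear_add[OF smooth_on_linear_fd[OF that p]] linear_cmul[OF smooth_on_linear_fd[OF that p]]
    by (simp add: Z_def lie)
  \<comment> \<open>The \<open>\<beta>\<close> terms cancel by \<open>rotY\<close>, while
    \<open>rotX\<close> turns the \<open>\<alpha>\<close> terms into the derivative of the middle
    surface.\<close>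
  have "m *\<^sub>R cross3 (n p) (fd n p Z) + fd r' p Z = \<alpha> *\<^sub>R (fd r p (X p) + fd r' p (X p))"
    unfolding lin[OF smooth(4)] lin[OF smooth(2)] rotX[OF p] rotY[OF p]
    by (simp add: cross_add_right cross_mult_right algebra_simps)
  then have 4: "m *\<^sub>R cross3 (n p) (fd n p Z) + fd r' p Z = (2 * \<alpha>) *\<^sub>R fd rm p (X p)"
    by (simp add: fd_rm[OF p])
  have "2 *\<^sub>R vf_deriv Y (vf_deriv X rm) p = vf_deriv Y (vf_deriv X r) p + vf_deriv Y (vf_deriv X r') p"
    by (simp add: vf_deriv_vf_deriv_rm[OF smoothXY(1) p])
  \<comment> \<open>\<open>rotY\<close> controls the derivative of \<open>r'\<close> along
    \<open>Y\<close> only, so the order of differentiation is reversed at the cost of the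
    bracket.\<close>
  also have "vf_deriv Y (vf_deriv X r') p = - m *\<^sub>R (cross3 (n p) (YXn + fd n p Z) + N) - fd r' p Z"
    using 2 3 by (simp add: eq_diff_eq)
  also have "vf_deriv Y (vf_deriv X r) p + (- m *\<^sub>R (cross3 (n p) (YXn + fd n p Z) + N) - fd r' p Z)
    = - (2 * m) *\<^sub>R N - (m *\<^sub>R cross3 (n p) (fd n p Z) + fd r' p Z)"
    unfolding 1 cross_add_right
    by (simp add: vec_eq_iff algebra_simps)
  also have "\<dots> = 2 *\<^sub>R (- m *\<^sub>R N - \<alpha> *\<^sub>R fd rm p (X p))"
    unfolding 4 by (simp add: algebra_simps)
  finally show YX: "vf_deriv Y (vf_deriv X rm) p =
      - m *\<^sub>R cross3 (fd n p (X p)) (fd n p (Y p)) - \<alpha> *\<^sub>R fd rm p (X p)"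
    by (simp add: N_def)
  show "vf_deriv X (vf_deriv Y rm) p =
      - m *\<^sub>R cross3 (fd n p (X p)) (fd n p (Y p)) + \<beta> *\<^sub>R fd rm p (Y p)"
    unfolding bracket[OF smooth(3)] YX using lin[OF smooth(3)] by (simp add: Z_def)
qed

lemma cross3_fd_n:
  assumes "p \<in> V"
  shows "cross3 (fd n p v) (fd n p w) \<bullet> fd rm p u = 0"
  unfolding weingarten_cross3[OF surfaces(3) gauss_rm assms]
  by (subst cross3_tangent[OF gauss_map_norm[OF gauss_rm assms] gauss_map_tangent[OF gauss_rm assms]
        gauss_map_tangent[OF gauss_rm assms]])
    (simp add: inner_commute[of "n p"] gauss_map_tangent[OF gauss_rm assms])

lemma cross3_rm_nonzero: "p \<in> V \<Longrightarrow> cross3 (fd rm p (X p)) (fd rm p (Y p)) \<noteq> 0"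
  by (rule cross3_independent_nonzero[OF regular_surfaceD(4)[OF surfaces(3)] regular_surfaceD(3)[OF surfaces(3)]
        net_onD(3)[OF net]])

text \<open>Each mixed derivative differentiates a unit vector field and is orthogonal to it. Its
  normal part does not contribute to the inner product, which leaves exactly
  \<open>- \<alpha>\<close> or \<open>\<beta>\<close>.\<close>

lemma unit_fields_commute:
  assumes unit: "\<And>q. q \<in> V \<Longrightarrow> norm (fd rm q (X q)) = 1" "\<And>q. q \<in> V \<Longrightarrow> norm (fd rm q (Y q)) = 1"
    and p: "p \<in> V"
  shows "lie_bracket X Y p = 0"
proof -
  obtain \<alpha> \<beta> where lie: "lie_bracket X Y p = \<alpha> *\<^sub>R X p + \<beta> *\<^sub>R Y p"
    by (rule net_on_expand[OF net p])
  have s: "smooth_on V (vf_deriv X rm)" "smooth_on V (vf_deriv Y rm)"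
    unfolding vf_deriv_def by (intro smooth_on_fd openV smooth smoothXY)+
  have "vf_deriv Y (vf_deriv X rm) p \<bullet> fd rm p (X p) = 0"
    using unit_fd_orthogonal[OF openV s(1) _ p] unit(1) by (simp add: vf_deriv_def)
  then have "\<alpha> = 0"
    unfolding mixed_derivatives_rm(1)[OF p lie]
    using unit(1)[OF p] by (auto simp: inner_diff_left cross3_fd_n[OF p] norm_eq_1)
  have "vf_deriv X (vf_deriv Y rm) p \<bullet> fd rm p (Y p) = 0"
    using unit_fd_orthogonal[OF openV s(2) _ p] unit(2) by (simp add: vf_deriv_def)
  then have "\<beta> = 0"
    unfolding mixed_derivatives_rm(2)[OF p lie]
    using unit(2)[OF p] by (auto simp: inner_diff_left inner_add_left cross3_fd_n[OF p] norm_eq_1)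
  show ?thesis using lie \<open>\<alpha> = 0\<close> \<open>\<beta> = 0\<close> by simp
qed

text \<open>The bracket term of the mixed derivative is tangential, so unit length is irrelevant
  here: the Schief curvature is \<open>- m\<close> times the Gauss curvature times the sign of
  \<open>\<rho>\<close>, constant on connected \<open>V\<close>.\<close>

lemma concordant_net_rm:
  assumes "connected V" "m \<noteq> 0"
  shows "concordant_net V rm n X Y"
proof -
  define \<rho> where "\<rho> = (\<lambda>p. cross3 (fd rm p (X p)) (fd rm p (Y p)) \<bullet> n p)"
  have cross: "cross3 (fd rm p (X p)) (fd rm p (Y p)) = \<rho> p *\<^sub>R n p" if "p \<in> V" for p
    unfolding \<rho>_def
    by (rule cross3_tangent[OF gauss_map_norm[OF gauss_rm that] gauss_map_tangent[OF gauss_rm that]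
          gauss_map_tangent[OF gauss_rm that]])
  have "\<rho> p \<noteq> 0" if "p \<in> V" for p
    using cross3_rm_nonzero[OF that] cross[OF that] by force
  moreover have "smooth_on V \<rho>" unfolding \<rho>_def
    by (intro smooth_on_inner smooth_on_cross3 smooth_on_fd openV smooth smoothXY)
  ultimately obtain \<epsilon> where \<epsilon>: "\<epsilon> \<in> {1, -1}" "\<And>p. p \<in> V \<Longrightarrow> \<rho> p = \<epsilon> * \<bar>\<rho> p\<bar>" and \<rho>: "\<And>p. p \<in> V \<Longrightarrow> \<rho> p \<noteq> 0"
    using constant_sign_on_connected[OF assms(1) smooth_on_continuous_on[of V \<rho>]] by metis
  have "gauss_curvature rm n p = (- \<epsilon> / m) * schief_curvature rm n X Y p" if p: "p \<in> V" for p
  proof -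
    have nn: "n p \<bullet> n p = 1" using gauss_map_norm[OF gauss_rm p] by (simp add: norm_eq_1)
    obtain \<alpha> \<beta> where lie: "lie_bracket X Y p = \<alpha> *\<^sub>R X p + \<beta> *\<^sub>R Y p"
      by (rule net_on_expand[OF net p])
    have "vf_deriv Y (vf_deriv X rm) p \<bullet> n p = - m * (gauss_curvature rm n p * \<rho> p)"
      unfolding mixed_derivatives_rm(1)[OF p lie] weingarten_cross3[OF surfaces(3) gauss_rm p] cross[OF p]
      by (simp add: inner_diff_left gauss_map_tangent[OF gauss_rm p] nn)
    moreover have "norm (cross3 (vf_deriv X rm p) (vf_deriv Y rm p)) = \<bar>\<rho> p\<bar>"
      unfolding vf_deriv_def cross[OF p] using gauss_map_norm[OF gauss_rm p] by simp
    ultimately have "schief_curvature rm n X Y p = - m * gauss_curvature rm n p * (\<rho> p / \<bar>\<rho> p\<bar>)"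
      by (simp add: schief_curvature_def)
    moreover have "\<rho> p / \<bar>\<rho> p\<bar> = \<epsilon>" using \<epsilon>(2)[OF p] \<rho>[OF p] by (metis abs_eq_0 nonzero_mult_div_cancel_right)
    moreover have "\<epsilon> * \<epsilon> = 1" using \<epsilon>(1) by auto
    ultimately show ?thesis using assms(2) by (auto simp: field_simps)
  qed
  then show ?thesis
    unfolding concordant_net_def by (intro conjI net exI[of _ "- \<epsilon> / m"] ballI)
qed

text \<open>Rescaling to unit length on the middle surface gives commuting fields; in their
  coordinates the first fundamental form has the Chebyshev shape.\<close>

lemma chebyshev_net_rm: "chebyshev_net V rm X Y"
proof -
  define a where "a = (\<lambda>q. inverse (norm (fd rm q (X q))))"
  define b where "b = (\<lambda>q. inverse (norm (fd rm q (Y q))))"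
  define e1 where "e1 = (\<lambda>q. a q *\<^sub>R X q)"
  define e2 where "e2 = (\<lambda>q. b q *\<^sub>R Y q)"
  note nz = regular_surface_fd_nonzero[OF surfaces(3) _ net_on_nonzero(1)[OF net]]
    regular_surface_fd_nonzero[OF surfaces(3) _ net_on_nonzero(2)[OF net]]
  have ab: "a q \<noteq> 0" "b q \<noteq> 0" if "q \<in> V" for q using nz that by (auto simp: a_def b_def)
  have smooth_e: "smooth_on V e1" "smooth_on V e2"
    unfolding e1_def e2_def a_def b_def
    by (intro smooth_on_scaleR smooth_on_inverse smooth_on_norm smooth_on_fd openV smooth smoothXY; use nz in simp)+
  have net_e: "net_on V e1 e2"
    unfolding net_on_def
  proof (intro conjI ballI allI impI smooth_e)
    fix q c d assume q: "q \<in> V" and "c *\<^sub>R e1 q + d *\<^sub>R e2 q = 0"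
    then have "(c * a q) *\<^sub>R X q + (d * b q) *\<^sub>R Y q = 0" by (simp add: e1_def e2_def)
    then show "c = 0" "d = 0" using net_onD(3)[OF net q] ab[OF q] by force+
  qed
  interpret unit: opposite_rotations V r r' n e1 e2 m
  proof
    fix q assume q: "q \<in> V"
    note lin = linear_cmul[OF smooth_on_linear_fd[OF _ q]]
    show "fd r q (e1 q) = m *\<^sub>R cross3 (n q) (fd n q (e1 q))"
      by (simp add: e1_def lin[OF smooth(1)] lin[OF smooth(4)] rotX[OF q] cross_mult_right)
    show "fd r' q (e2 q) = - m *\<^sub>R cross3 (n q) (fd n q (e2 q))"
      by (simp add: e2_def lin[OF smooth(2)] lin[OF smooth(4)] rotY[OF q] cross_mult_right)
  qed (fact surfaces gauss net_e)+
  have norm_e: "norm (fd rm q (e1 q)) = 1" "norm (fd rm q (e2 q)) = 1" if q: "q \<in> V" for q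
    using nz(1)[OF q q] nz(2)[OF q q] unfolding e1_def e2_def linear_cmul[OF smooth_on_linear_fd[OF smooth(3) q]]
    by (simp_all add: a_def b_def)
  define g where "g = (\<lambda>q. fd rm q (e1 q) \<bullet> fd rm q (e2 q))"
  \<comment> \<open>Transversality keeps the cosine of the net angle away from 1 and -1, where
    \<open>arccos\<close> is not smooth.\<close>
  have g: "\<bar>g q\<bar> < 1" if q: "q \<in> V" for q
  proof -
    have "(norm (cross3 (fd rm q (e1 q)) (fd rm q (e2 q))))\<^sup>2 = 1 - (g q)\<^sup>2"
      unfolding norm_cross g_def norm_e[OF q] by simp
    moreover have "(norm (cross3 (fd rm q (e1 q)) (fd rm q (e2 q))))\<^sup>2 > 0"
      using unit.cross3_rm_nonzero[OF q] by simp
    ultimately show ?thesis by (simp add: abs_square_less_1)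
  qed
  have smooth_g: "smooth_on V g"
    unfolding g_def by (intro smooth_on_inner smooth_on_fd openV smooth smooth_e)
  have "\<exists>V' W \<phi> \<psi> \<omega>. open V' \<and> p \<in> V' \<and> V' \<subseteq> V \<and> open W \<and> homeomorphism W V' \<phi> \<psi> \<and>
      smooth_on W \<phi> \<and> smooth_on V' \<psi> \<and> smooth_on W (\<omega> :: real \<times> real \<Rightarrow> real) \<and>
      (\<forall>q\<in>W. (\<exists>a. fd \<phi> q (1,0) = a *\<^sub>R X (\<phi> q)) \<and> (\<exists>b. fd \<phi> q (0,1) = b *\<^sub>R Y (\<phi> q)) \<and>
        first_form (rm \<circ> \<phi>) q (1,0) (1,0) = 1 \<and> first_form (rm \<circ> \<phi>) q (1,0) (0,1) = cos (\<omega> q) \<and>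
        first_form (rm \<circ> \<phi>) q (0,1) (0,1) = 1)" if p: "p \<in> V" for p
  proof -
    obtain V' W and \<phi> \<psi> :: "real \<times> real \<Rightarrow> real \<times> real"
      where V': "open V'" "p \<in> V'" "V' \<subseteq> V" "open W" "homeomorphism W V' \<phi> \<psi>"
      and smooth\<phi>: "smooth_on W \<phi>" and smooth\<psi>: "smooth_on V' \<psi>"
      and d1: "\<And>q. q \<in> W \<Longrightarrow> fd \<phi> q (1,0) = e1 (\<phi> q)" and d2: "\<And>q. q \<in> W \<Longrightarrow> fd \<phi> q (0,1) = e2 (\<phi> q)"
      using commuting_frame_coordinates[OF openV net_e unit.unit_fields_commute[OF norm_e] p] by blast
    have \<phi>V: "\<phi> q \<in> V" if "q \<in> W" for q using V'(3,5) that by (auto simp: homeomorphism_def)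
    have smooth\<omega>: "smooth_on W (\<lambda>q. arccos (g (\<phi> q)))"
      by (rule smooth_on_arccos[OF V'(4) smooth_on_compose[OF V'(4) openV image_subsetI[OF \<phi>V] smooth\<phi> smooth_g] g[OF \<phi>V]])
    have "fd (rm \<circ> \<phi>) q v = fd rm (\<phi> q) (fd \<phi> q v)" if "q \<in> W" for q v
      unfolding o_def
      by (rule fun_cong[OF fd_eqI[OF has_derivative_compose[OF smooth_on_has_derivative[OF smooth\<phi> that]
                smooth_on_has_derivative[OF smooth(3) \<phi>V[OF that]]]]])
    then have "first_form (rm \<circ> \<phi>) q (1,0) (1,0) = 1" "first_form (rm \<circ> \<phi>) q (0,1) (0,1) = 1"
      "first_form (rm \<circ> \<phi>) q (1,0) (0,1) = cos (arccos (g (\<phi> q)))" if "q \<in> W" for q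
      using norm_e[OF \<phi>V[OF that]] g[OF \<phi>V[OF that]] that
      by (simp_all add: first_form_def d1 d2 norm_eq_1 fun_cong[OF g_def, symmetric] cos_arccos_abs)
    moreover have "\<exists>a. fd \<phi> q (1,0) = a *\<^sub>R X (\<phi> q)" "\<exists>b. fd \<phi> q (0,1) = b *\<^sub>R Y (\<phi> q)" if "q \<in> W" for q
      using d1[OF that] d2[OF that] by (auto simp: e1_def e2_def)
    ultimately show ?thesis
      using V' smooth\<phi> smooth\<psi> smooth\<omega>
      by (intro exI[of _ V'] exI[of _ W] exI[of _ \<phi>] exI[of _ \<psi>] exI[of _ "\<lambda>q. arccos (g (\<phi> q))"]) blast
  qed
  then show ?thesis using net unfolding chebyshev_net_def by blast
qed

end

section \<open>Pairing the asymptotic families of the two surfaces\<close>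

lemma rotation_inverse:
  assumes "norm n = 1" "u \<bullet> n = 0" "w = s *\<^sub>R cross3 n u" "s \<noteq> 0"
  shows "u = - (1 / s) *\<^sub>R cross3 n w"
  using assms by (simp add: cross_mult_right cross3_unit_normal)

lemma concordant_chebyshev_net_middle_surface:
  assumes surfaces: "regular_surface V r" "regular_surface V r'" "regular_surface V (middle_surface r r')"
    and gauss: "gauss_map V r n" "gauss_map V r' n" and net: "net_on V X Y"
    and rot: "\<And>p. p \<in> V \<Longrightarrow> fd n p (X p) = s *\<^sub>R cross3 (n p) (fd r p (X p))"
      "\<And>p. p \<in> V \<Longrightarrow> fd n p (Y p) = - s *\<^sub>R cross3 (n p) (fd r' p (Y p))"
    and "s \<noteq> 0" "connected V"
  shows "concordant_chebyshev_net V (middle_surface r r') n X Y"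
proof -
  interpret opposite_rotations V r r' n X Y "- (1 / s)"
  proof
    fix p assume p: "p \<in> V"
    show "fd r p (X p) = - (1 / s) *\<^sub>R cross3 (n p) (fd n p (X p))"
      by (rule rotation_inverse[OF gauss_map_norm[OF gauss(1) p] gauss_map_tangent[OF gauss(1) p] rot(1)[OF p] \<open>s \<noteq> 0\<close>])
    show "fd r' p (Y p) = - (- (1 / s)) *\<^sub>R cross3 (n p) (fd n p (Y p))"
      using rotation_inverse[OF gauss_map_norm[OF gauss(2) p] gauss_map_tangent[OF gauss(2) p] rot(2)[OF p]] \<open>s \<noteq> 0\<close>
      by simp
  qed (fact surfaces gauss net)+
  show ?thesis
    unfolding concordant_chebyshev_net_def using chebyshev_net_rm concordant_net_rm assms(9,10) by simp
qed

text \<open>If the two directions were dependent at a point, one would be a multiple of the other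
  and hence asymptotic for both surfaces.\<close>

lemma net_on_no_common_asymptotic:
  assumes "asymptotic_net V r n A1 A2" "asymptotic_net V r' n' B1 B2"
    and nc: "\<And>p v. p \<in> V \<Longrightarrow> asymptotic_direction r n p v \<Longrightarrow> \<not> asymptotic_direction r' n' p v"
    and "smooth_on V r'" "smooth_on V n'" and A: "A \<in> {A1, A2}" and B: "B \<in> {B1, B2}"
  shows "net_on V A B"
  unfolding net_on_def
proof (intro conjI ballI allI impI)
  show "smooth_on V A" "smooth_on V B"
    using assms unfolding asymptotic_net_def net_on_def by blast+
  fix p a b assume p: "p \<in> V" and ab: "a *\<^sub>R A p + b *\<^sub>R B p = 0"
  have Ap: "asymptotic_direction r n p (A p)" and Bp: "asymptotic_direction r' n' p (B p)"
    using assms(1,2) A B p unfolding asymptotic_net_def by blast+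
  have "a = 0"
  proof (rule ccontr)
    assume "a \<noteq> 0"
    have "A p = (- b / a) *\<^sub>R B p"
    proof -
      have "(1 / a) *\<^sub>R (a *\<^sub>R A p + b *\<^sub>R B p) = 0" using ab by simp
      then show ?thesis using \<open>a \<noteq> 0\<close> by (simp add: scaleR_add_right eq_neg_iff_add_eq_0)
    qed
    moreover have "asymptotic_direction r' n' p (c *\<^sub>R B p)" if "c *\<^sub>R B p \<noteq> 0" for c
      using Bp that unfolding asymptotic_direction_def second_form_def
        linear_cmul[OF smooth_on_linear_fd[OF assms(4) p]] linear_cmul[OF smooth_on_linear_fd[OF assms(5) p]]
      by simp
    moreover have "A p \<noteq> 0" using Ap by (simp add: asymptotic_direction_def)
    ultimately show False using nc[OF p Ap] by metis
  qed
  moreover have "B p \<noteq> 0" using Bp by (simp add: asymptotic_direction_def)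
  ultimately show "a = 0" "b = 0" using ab by auto
qed

text \<open>The first conjunct provides asymptotic families near every point, so the grouping in the
  second is not vacuous. Connectedness of \<open>V\<close> fixes the signs of the rotation factors,
  and thereby one grouping on all of \<open>V\<close>.\<close>

theorem theorem9p3:
  fixes U :: "(real \<times> real) set"
    and r r' \<gamma> \<gamma>' :: "real \<times> real \<Rightarrow> real ^ 3"
    and \<kappa> :: real
  assumes parallelism: "parallel_surfaces U r \<gamma> r' \<gamma>'"
    and "\<kappa> \<noteq> 0"
    and "\<And>p. p \<in> U \<Longrightarrow> gauss_curvature r \<gamma> p = - \<kappa>\<^sup>2"
    and "\<And>p. p \<in> U \<Longrightarrow> gauss_curvature r' \<gamma>' p = - \<kappa>\<^sup>2"
    and "regular_surface U (middle_surface r r')"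
    and "\<And>p v. p \<in> U \<Longrightarrow> asymptotic_direction r \<gamma> p v \<Longrightarrow> \<not> asymptotic_direction r' \<gamma>' p v"
  shows
    "(\<forall>p\<in>U. \<exists>V A1 A2 B1 B2. open V \<and> p \<in> V \<and> V \<subseteq> U \<and>
        asymptotic_net V r \<gamma> A1 A2 \<and> asymptotic_net V r' \<gamma>' B1 B2) \<and>
     (\<forall>V A1 A2 B1 B2. open V \<and> connected V \<and> V \<subseteq> U \<and>
        asymptotic_net V r \<gamma> A1 A2 \<and> asymptotic_net V r' \<gamma>' B1 B2 \<longrightarrow>
        (concordant_chebyshev_net V (middle_surface r r') \<gamma> A1 B1 \<and>
         concordant_chebyshev_net V (middle_surface r r') \<gamma> A2 B2) \<or>
        (concordant_chebyshev_net V (middle_surface r r') \<gamma> A1 B2 \<and>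
         concordant_chebyshev_net V (middle_surface r r') \<gamma> A2 B1))"
proof -
  have r: "regular_surface U r" "gauss_map U r \<gamma>" and r': "regular_surface U r'" "gauss_map U r' \<gamma>'"
    and eq: "\<And>p. p \<in> U \<Longrightarrow> \<gamma> p = \<gamma>' p"
    using parallelism by (auto simp: parallel_surfaces_def)
  have neg: "- \<kappa>\<^sup>2 < 0" using \<open>\<kappa> \<noteq> 0\<close> by simp
  have existence: "\<exists>V A1 A2 B1 B2. open V \<and> p \<in> V \<and> V \<subseteq> U \<and>
      asymptotic_net V r \<gamma> A1 A2 \<and> asymptotic_net V r' \<gamma>' B1 B2" if p: "p \<in> U" for p
  proof -
    obtain V A1 A2 where V: "open V" "p \<in> V" "V \<subseteq> U" "asymptotic_net V r \<gamma> A1 A2"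
      by (rule local_asymptotic_net[OF r p]) (use assms(3) neg in auto)
    obtain V' B1 B2 where V': "open V'" "p \<in> V'" "V' \<subseteq> U" "asymptotic_net V' r' \<gamma>' B1 B2"
      by (rule local_asymptotic_net[OF r' p]) (use assms(4) neg in auto)
    have "asymptotic_net (V \<inter> V') r \<gamma> A1 A2" "asymptotic_net (V \<inter> V') r' \<gamma>' B1 B2"
      using asymptotic_net_subset[OF V(4)] asymptotic_net_subset[OF V'(4)] by auto
    then show ?thesis using V V' open_Int by blast
  qed
  have grouping: "(concordant_chebyshev_net V (middle_surface r r') \<gamma> A1 B1 \<and>
         concordant_chebyshev_net V (middle_surface r r') \<gamma> A2 B2) \<or>
        (concordant_chebyshev_net V (middle_surface r r') \<gamma> A1 B2 \<and>
         concordant_chebyshev_net V (middle_surface r r') \<gamma> A2 B1)"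
    if V: "open V" "connected V" "V \<subseteq> U"
      and A: "asymptotic_net V r \<gamma> A1 A2" and B: "asymptotic_net V r' \<gamma>' B1 B2" for V A1 A2 B1 B2
  proof -
    note rV = regular_surface_subset[OF r(1) V(1,3)] regular_surface_subset[OF r'(1) V(1,3)]
      regular_surface_subset[OF assms(5) V(1,3)]
    \<comment> \<open>The two Gauss maps coincide only on \<open>U\<close>, so equality of their
      derivatives uses that \<open>V\<close> is open.\<close>
    have eqV: "fd \<gamma> p = fd \<gamma>' p" if "p \<in> V" for p
      by (rule frechet_derivative_cong_open[OF V(1) that]) (use eq V(3) in blast)
    note g = gauss_map_subset[OF r(2) V(3)] gauss_map_subset[OF r'(2) V(3)]
    have g': "gauss_map V r' \<gamma>"
      unfolding gauss_map_def
    proof (intro conjI ballI allI)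
      fix p v assume p: "p \<in> V"
      then have "\<gamma> p = \<gamma>' p" using eq V(3) by blast
      then show "fd r' p v \<bullet> \<gamma> p = 0" using gauss_map_tangent[OF g(2) p] by simp
    qed (use gauss_map_norm[OF g(1)] gauss_map_smooth[OF g(1)] in auto)
    obtain s where s: "s \<in> {\<kappa>, - \<kappa>}"
      and rotA: "\<And>p. p \<in> V \<Longrightarrow> fd \<gamma> p (A1 p) = s *\<^sub>R cross3 (\<gamma> p) (fd r p (A1 p))"
        "\<And>p. p \<in> V \<Longrightarrow> fd \<gamma> p (A2 p) = - s *\<^sub>R cross3 (\<gamma> p) (fd r p (A2 p))"
      using asymptotic_net_rotates[OF rV(1) g(1) A V(2) \<open>\<kappa> \<noteq> 0\<close>] assms(3) V(3) by blast
    obtain t where t: "t \<in> {\<kappa>, - \<kappa>}"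
      and rotB': "\<And>p. p \<in> V \<Longrightarrow> fd \<gamma>' p (B1 p) = t *\<^sub>R cross3 (\<gamma>' p) (fd r' p (B1 p))"
        "\<And>p. p \<in> V \<Longrightarrow> fd \<gamma>' p (B2 p) = - t *\<^sub>R cross3 (\<gamma>' p) (fd r' p (B2 p))"
      using asymptotic_net_rotates[OF rV(2) g(2) B V(2) \<open>\<kappa> \<noteq> 0\<close>] assms(4) V(3) by blast
    have rotB: "fd \<gamma> p (B1 p) = t *\<^sub>R cross3 (\<gamma> p) (fd r' p (B1 p))"
      "fd \<gamma> p (B2 p) = - t *\<^sub>R cross3 (\<gamma> p) (fd r' p (B2 p))" if "p \<in> V" for p
      using rotB'[OF that] eqV[OF that] eq[OF subsetD[OF V(3) that]] by simp_all
    have net: "net_on V A' B'" if "A' \<in> {A1, A2}" "B' \<in> {B1, B2}" for A' B'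
    proof (rule net_on_no_common_asymptotic[OF A B _ _ _ that])
      show "\<not> asymptotic_direction r' \<gamma>' p v" if "p \<in> V" "asymptotic_direction r \<gamma> p v" for p v
        using assms(6) that V(3) by blast
    qed (use regular_surfaceD(2)[OF rV(2)] gauss_map_smooth[OF g(2)] in auto)
    note ccn = concordant_chebyshev_net_middle_surface[OF rV g(1) g' net]
    have s0: "s \<noteq> 0" "- s \<noteq> 0" using s \<open>\<kappa> \<noteq> 0\<close> by auto
    \<comment> \<open>The factors of \<open>A1\<close>, \<open>A2\<close>, \<open>B1\<close>,
      \<open>B2\<close> are \<open>s\<close>, \<open>- s\<close>, \<open>t\<close>,
      \<open>- t\<close>, all equal up to sign; a family of one surface is paired with the family of
      the other that has the opposite factor.\<close>
    consider "t = - s" | "t = s" using s t by fastforce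
    then show ?thesis
    proof cases
      case 1
      have "concordant_chebyshev_net V (middle_surface r r') \<gamma> A1 B1"
        by (rule ccn[OF _ _ rotA(1) _ s0(1) V(2)]) (use rotB 1 in auto)
      moreover have "concordant_chebyshev_net V (middle_surface r r') \<gamma> A2 B2"
        by (rule ccn[OF _ _ rotA(2) _ s0(2) V(2)]) (use rotB 1 in auto)
      ultimately show ?thesis by blast
    next
      case 2
      have "concordant_chebyshev_net V (middle_surface r r') \<gamma> A1 B2"
        by (rule ccn[OF _ _ rotA(1) _ s0(1) V(2)]) (use rotB 2 in auto)
      moreover have "concordant_chebyshev_net V (middle_surface r r') \<gamma> A2 B1"
        by (rule ccn[OF _ _ rotA(2) _ s0(2) V(2)]) (use rotB 2 in auto)
      ultimately show ?thesis by blast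
    qed
  qed
  show ?thesis
  proof (intro conjI ballI allI impI)
    show "\<exists>V A1 A2 B1 B2. open V \<and> p \<in> V \<and> V \<subseteq> U \<and>
      asymptotic_net V r \<gamma> A1 A2 \<and> asymptotic_net V r' \<gamma>' B1 B2" if "p \<in> U" for p
      by (rule existence[OF that])
  qed (elim conjE, rule grouping)
qed

end
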